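(* Let $E$ be an arbitrary directed graph, $K$ a field, and $L = L_K(E)$ the Leavitt path algebra of $E$ over $K$. If $M$ is a maximal ideal of $L$ which is non-graded, then $gr(M)$, the largest graded ideal of $L$ contained in $M$, is maximal among the proper graded ideals of $L$.
   Context: A directed graph $E=(E^0,E^1,r,s)$ consists of a set $E^0$ of vertices, a set $E^1$ of edges, and range and source maps $r,s:E^1\to E^0$ (no finiteness or cardinality assumptions). A vertex is regular if it emits a non-empty finite set of edges. The Leavitt path algebra $L_K(E)$ is the (associative, not necessarily unital) $K$-algebra generated by pairwise orthogonal idempotents $\{v: v\in E^0\}$ together with elements $\{e,e^*: e\in E^1\}$ subject to: (1) $s(e)e=e=e\,r(e)$ for all $e\in E^1$; (2) $r(e)e^*=e^*=e^*s(e)$ for all $e\in E^1$; (3) $e^*e=r(e)$ and $e^*f=0$ for $e\neq f$ in $E^1$; (4) $v=\sum_{e\in E^1,\,s(e)=v} ee^*$ for every regular vertex $v$. It has local units (finite sums of distinct vertices), and is unital iff $E^0$ is finite. $L_K(E)=\bigoplus_{n\in\mathbb{Z}} L_n$ is $\mathbb{Z}$-graded by $\deg v=0$, $\deg e=1$, $\deg e^*=-1$. Ideals are two-sided. An ideal $I$ is graded if $I=\bigoplus_{n\in\mathbb{Z}}(I\cap L_n)$, and non-graded otherwise. A maximal ideal is a maximal element of the set of all proper ideals of $L_K(E)$ ordered by inclusion. *)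

theory Defs
  imports
    "HOL-Library.Poly_Mapping"
    "HOL-Algebra.QuotRing"
    "Graph_Theory.Digraph"
begin

section \<open>The free associative algebra on a set of symbols\<close>

text \<open>
  Lists under concatenation are the free monoid. With this instance the convolution product that
  Poly_Mapping puts on \<open>'a list \<Rightarrow>\<^sub>0 'k\<close> is the product of the free unital
  associative \<open>'k\<close>-algebra on \<open>'a\<close>: the word \<open>w\<close> with coefficient
  \<open>c\<close> is \<open>single w c\<close>, and \<open>single [] c\<close> is the scalar
  \<open>c\<close>.
\<close>

instantiation list :: (type) monoid_add
begin

definition zero_list :: "'a list" where "zero_list = []"

definition plus_list :: "'a list \<Rightarrow> 'a list \<Rightarrow> 'a list" where "plus_list = (@)"

instance by standard (simp_all add: zero_list_def plus_list_def)

end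

definition free_algebra :: "'a set \<Rightarrow> ('a list \<Rightarrow>\<^sub>0 'k::field) ring" where
  "free_algebra X =
    \<lparr>carrier = {f. Poly_Mapping.keys f \<subseteq> lists X}, mult = (*), one = 1, zero = 0, add = (+)\<rparr>"

text \<open>
  The free non-unital algebra is spanned by the non-empty words. The field \<open>one\<close> inherited
  from the free unital algebra lies outside the carrier and is never referred to; the record type is
  only used for its additive structure, its product and its quotients.
\<close>

definition free_nonunital_algebra :: "'a set \<Rightarrow> ('a list \<Rightarrow>\<^sub>0 'k::field) ring" where
  "free_nonunital_algebra X =
    (free_algebra X)\<lparr>carrier := {f. Poly_Mapping.keys f \<subseteq> lists X - {[]}}\<rparr>"

section \<open>Leavitt path algebras\<close>

text \<open>
  The source of an edge \<open>e\<close> is \<open>tail E e\<close>, its range is \<open>head E e\<close>.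
\<close>

datatype ('v, 'e) lpa_gen = Vertex 'v | Edge 'e | Ghost 'e

definition lpa_gens :: "('v, 'e) pre_digraph \<Rightarrow> ('v, 'e) lpa_gen set" where
  "lpa_gens E = Vertex ` verts E \<union> Edge ` arcs E \<union> Ghost ` arcs E"

definition regular_vertex :: "('v, 'e) pre_digraph \<Rightarrow> 'v \<Rightarrow> bool" where
  "regular_vertex E v \<longleftrightarrow> v \<in> verts E \<and> out_arcs E v \<noteq> {} \<and> finite (out_arcs E v)"

abbreviation gen :: "'a \<Rightarrow> 'a list \<Rightarrow>\<^sub>0 'k::field" where
  "gen x \<equiv> Poly_Mapping.single [x] 1"

text \<open>
  Each relation \<open>a = b\<close> is represented by the element \<open>a - b\<close>.
\<close>

definition lpa_relations ::
    "('v, 'e) pre_digraph \<Rightarrow> (('v, 'e) lpa_gen list \<Rightarrow>\<^sub>0 'k::field) set" where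
  "lpa_relations E =
      {gen (Vertex v) * gen (Vertex v) - gen (Vertex v) | v. v \<in> verts E}
    \<union> {gen (Vertex v) * gen (Vertex w) | v w. v \<in> verts E \<and> w \<in> verts E \<and> v \<noteq> w}
    \<union> {gen (Vertex (tail E e)) * gen (Edge e) - gen (Edge e) | e. e \<in> arcs E}
    \<union> {gen (Edge e) * gen (Vertex (head E e)) - gen (Edge e) | e. e \<in> arcs E}
    \<union> {gen (Vertex (head E e)) * gen (Ghost e) - gen (Ghost e) | e. e \<in> arcs E}
    \<union> {gen (Ghost e) * gen (Vertex (tail E e)) - gen (Ghost e) | e. e \<in> arcs E}
    \<union> {gen (Ghost e) * gen (Edge e) - gen (Vertex (head E e)) | e. e \<in> arcs E}
    \<union> {gen (Ghost e) * gen (Edge f) | e f. e \<in> arcs E \<and> f \<in> arcs E \<and> e \<noteq> f}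
    \<union> {gen (Vertex v) - (\<Sum>e\<in>out_arcs E v. gen (Edge e) * gen (Ghost e)) | v. regular_vertex E v}"

text \<open>
  The ideal is generated in the unital free algebra, which contains the scalars, so it is a
  subspace. It is contained in the non-unital free algebra, where it is the smallest two-sided
  algebra ideal that contains the relations.
\<close>

definition lpa_ideal ::
    "('v, 'e) pre_digraph \<Rightarrow> (('v, 'e) lpa_gen list \<Rightarrow>\<^sub>0 'k::field) set" where
  "lpa_ideal E = Idl\<^bsub>free_algebra (lpa_gens E)\<^esub> (lpa_relations E)"

text \<open>
  The algebra is not unital in general; as above, the field \<open>one\<close> of the record carries no
  meaning.
\<close>

definition leavitt ::
    "('v, 'e) pre_digraph \<Rightarrow> (('v, 'e) lpa_gen list \<Rightarrow>\<^sub>0 'k::field) set ring" where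
  "leavitt E = free_nonunital_algebra (lpa_gens E) Quot lpa_ideal E"

fun gen_deg :: "('v, 'e) lpa_gen \<Rightarrow> int" where
  "gen_deg (Vertex v) = 0"
| "gen_deg (Edge e) = 1"
| "gen_deg (Ghost e) = -1"

definition word_deg :: "('v, 'e) lpa_gen list \<Rightarrow> int" where
  "word_deg w = sum_list (map gen_deg w)"

definition leavitt_comp ::
    "('v, 'e) pre_digraph \<Rightarrow> int \<Rightarrow> (('v, 'e) lpa_gen list \<Rightarrow>\<^sub>0 'k::field) set set" where
  "leavitt_comp E n =
    {lpa_ideal E +>\<^bsub>free_nonunital_algebra (lpa_gens E)\<^esub> f | f.
      f \<in> carrier (free_nonunital_algebra (lpa_gens E)) \<and>
      (\<forall>w \<in> Poly_Mapping.keys f. word_deg w = n)}"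

section \<open>Ideals and graded ideals\<close>

text \<open>
  This is the library's \<open>ideal\<close> without the assumption that the ring has a unit.
  In a Leavitt path algebra closure under scalars is automatic, because there are local units:
  if \<open>u x = x\<close> then \<open>c x = (c u) x\<close>.
\<close>

definition two_sided_ideal :: "'a set \<Rightarrow> ('a, 'm) ring_scheme \<Rightarrow> bool" where
  "two_sided_ideal I R \<longleftrightarrow> additive_subgroup I R \<and>
    (\<forall>a\<in>I. \<forall>x\<in>carrier R. x \<otimes>\<^bsub>R\<^esub> a \<in> I \<and> a \<otimes>\<^bsub>R\<^esub> x \<in> I)"

definition maximal_ideal :: "'a set \<Rightarrow> ('a, 'm) ring_scheme \<Rightarrow> bool" where
  "maximal_ideal M R \<longleftrightarrow> two_sided_ideal M R \<and> M \<noteq> carrier R \<and>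
    (\<forall>J. two_sided_ideal J R \<and> J \<noteq> carrier R \<and> M \<subseteq> J \<longrightarrow> J = M)"

text \<open>
  \<open>S\<close> is the internal direct sum of the \<open>H n\<close>: every element of
  \<open>S\<close> is the sum of exactly one finitely supported family with members in the
  \<open>H n\<close>, and every such sum is in \<open>S\<close>.
\<close>

definition is_direct_sum :: "('a, 'm) ring_scheme \<Rightarrow> 'a set \<Rightarrow> ('i \<Rightarrow> 'a set) \<Rightarrow> bool" where
  "is_direct_sum R S H \<longleftrightarrow>
    bij_betw (\<lambda>x. \<Oplus>\<^bsub>R\<^esub>n\<in>{n. x n \<noteq> \<zero>\<^bsub>R\<^esub>}. x n)
      {x. (\<forall>n. x n \<in> H n) \<and> finite {n. x n \<noteq> \<zero>\<^bsub>R\<^esub>}} S"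

definition graded_ideal ::
    "(('v, 'e) lpa_gen list \<Rightarrow>\<^sub>0 'k::field) set set \<Rightarrow> ('v, 'e) pre_digraph \<Rightarrow> bool" where
  "graded_ideal I E \<longleftrightarrow> two_sided_ideal I (leavitt E) \<and>
    is_direct_sum (leavitt E) I (\<lambda>n. I \<inter> leavitt_comp E n)"

text \<open>The greatest element, with respect to inclusion, of the graded ideals inside \<open>I\<close>.\<close>

definition gr ::
    "('v, 'e) pre_digraph \<Rightarrow> (('v, 'e) lpa_gen list \<Rightarrow>\<^sub>0 'k::field) set set
      \<Rightarrow> (('v, 'e) lpa_gen list \<Rightarrow>\<^sub>0 'k) set set" where
  "gr E I = (GREATEST J. graded_ideal J E \<and> J \<subseteq> I)"

definition maximal_graded_ideal ::
    "(('v, 'e) lpa_gen list \<Rightarrow>\<^sub>0 'k::field) set set \<Rightarrow> ('v, 'e) pre_digraph \<Rightarrow> bool" where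
  "maximal_graded_ideal N E \<longleftrightarrow> graded_ideal N E \<and> N \<noteq> carrier (leavitt E) \<and>
    (\<forall>J. graded_ideal J E \<and> J \<noteq> carrier (leavitt E) \<and> N \<subseteq> J \<longrightarrow> J = N)"

end

theory Submission
  imports Defs
begin

text \<open>
  Let \<open>J\<close> be a graded ideal that properly contains \<open>gr(M)\<close>. Then \<open>J\<close> is not inside \<open>M\<close>, so
  \<open>M + J = L\<close>, and every vertex is \<open>v = m + j\<close> with \<open>m \<in> M\<close> and \<open>j \<in> J\<close>. The homogeneous parts of
  \<open>j\<close> lie in \<open>J\<close> and have a common left unit \<open>f \<in> J\<close> of degree zero. Then \<open>f j = j\<close>, hence
  \<open>v - f v = m - f m\<close> is a homogeneous element of \<open>M\<close>, so it lies in \<open>gr(M) \<subseteq> J\<close>. It follows that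
  \<open>v \<in> J\<close> for all \<open>v\<close>, that is, \<open>J = L\<close>.

  The left units exist because \<open>x = \<Sum>e\<in>F. e (e\<^sup>* x) + w x\<close> with \<open>w = v - \<Sum>e\<in>F. e e\<^sup>*\<close> for every
  homogeneous \<open>x\<close> with left end \<open>v\<close>. In monomials \<open>p q\<^sup>*\<close> of \<open>e\<^sup>* x\<close> the path \<open>p\<close> is shorter, so by
  induction \<open>e\<^sup>* x\<close> has a left unit \<open>f\<^sub>e\<close>. If \<open>F\<close> is large then \<open>w x\<close> is \<open>w\<close> times a combination
  of ghost paths of the same length; therefore \<open>w x = 0\<close> or \<open>w\<close> is in the ideal generated by \<open>x\<close>.
  The left unit is \<open>\<Sum>e\<in>F. e f\<^sub>e e\<^sup>*\<close>, plus \<open>w\<close> in the second case.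
\<close>

section \<open>Two-sided ideals of a ring with one\<close>

text \<open>Ideals are subsets of a whole type, where every element may serve as a factor;
  calculations then need no carrier conditions.\<close>

locale tideal =
  fixes S :: "'a::ring_1 set"
  assumes zero: "0 \<in> S"
    and add: "x \<in> S \<Longrightarrow> y \<in> S \<Longrightarrow> x + y \<in> S"
    and mult_left: "x \<in> S \<Longrightarrow> a * x \<in> S"
    and mult_right: "x \<in> S \<Longrightarrow> x * a \<in> S"
begin

lemma uminus: "x \<in> S \<Longrightarrow> - x \<in> S"
  using mult_left[of x "-1"] by simp

lemma diff: "x \<in> S \<Longrightarrow> y \<in> S \<Longrightarrow> x - y \<in> S"
  using add[of x "- y"] uminus by simp

lemma sum: "(\<And>i. i \<in> F \<Longrightarrow> f i \<in> S) \<Longrightarrow> sum f F \<in> S"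
  by (induction F rule: infinite_finite_induct) (auto intro: zero add)

definition cong :: "'a \<Rightarrow> 'a \<Rightarrow> bool" (infix "\<approx>" 50) where
  "x \<approx> y \<longleftrightarrow> x - y \<in> S"

lemma cong_refl [simp, intro!]: "x \<approx> x"
  by (simp add: cong_def zero)

lemma cong_sym: "x \<approx> y \<Longrightarrow> y \<approx> x"
  unfolding cong_def using uminus[of "x - y"] by simp

lemma cong_trans [trans]: "x \<approx> y \<Longrightarrow> y \<approx> z \<Longrightarrow> x \<approx> z"
  unfolding cong_def using add[of "x - y" "y - z"] by simp

lemma cong_add: "x \<approx> y \<Longrightarrow> x' \<approx> y' \<Longrightarrow> x + x' \<approx> y + y'"
  unfolding cong_def using add[of "x - y" "x' - y'"] by (simp add: algebra_simps)

lemma cong_diff: "x \<approx> y \<Longrightarrow> x' \<approx> y' \<Longrightarrow> x - x' \<approx> y - y'"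
  unfolding cong_def using diff[of "x - y" "x' - y'"] by (simp add: algebra_simps)

lemma cong_left: "x \<approx> y \<Longrightarrow> a * x \<approx> a * y"
  unfolding cong_def using mult_left[of "x - y" a] by (simp add: algebra_simps)

lemma cong_right: "x \<approx> y \<Longrightarrow> x * a \<approx> y * a"
  unfolding cong_def using mult_right[of "x - y" a] by (simp add: algebra_simps)

lemma cong_sum: "(\<And>i. i \<in> F \<Longrightarrow> f i \<approx> g i) \<Longrightarrow> sum f F \<approx> sum g F"
  by (induction F rule: infinite_finite_induct) (auto intro: cong_add)

lemma cong_mem: "x \<approx> y \<Longrightarrow> y \<in> T \<Longrightarrow> S \<subseteq> T \<Longrightarrow> tideal T \<Longrightarrow> x \<in> T"
  using tideal.add[of T "x - y" y] by (auto simp: cong_def)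

lemma cong_0_iff: "x \<approx> 0 \<longleftrightarrow> x \<in> S"
  by (simp add: cong_def)

end

section \<open>Restricting the support of a finitely supported function\<close>

text \<open>One operator serves two purposes: truncation to words over an alphabet
  (\<open>words_in\<close>) and passage to homogeneous components (\<open>hom_part\<close>).\<close>

definition restr :: "('a \<Rightarrow> bool) \<Rightarrow> ('a \<Rightarrow>\<^sub>0 'b::zero) \<Rightarrow> 'a \<Rightarrow>\<^sub>0 'b" where
  "restr P = Poly_Mapping.mapp (\<lambda>w c. c when P w)"

lemma lookup_restr: "Poly_Mapping.lookup (restr P f) w = (Poly_Mapping.lookup f w when P w)"
  by (auto simp: restr_def lookup_mapp when_def in_keys_iff)

lemma restr_zero [simp]: "restr P 0 = 0"
  by (rule poly_mapping_eqI) (simp add: lookup_restr)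

lemma restr_add: "restr P (f + g) = restr P f + restr P g" for f :: "'a \<Rightarrow>\<^sub>0 'b::monoid_add"
  by (rule poly_mapping_eqI) (simp add: lookup_restr lookup_add when_def)

lemma restr_uminus: "restr P (- f) = - restr P f" for f :: "'a \<Rightarrow>\<^sub>0 'b::ab_group_add"
  by (rule poly_mapping_eqI) (simp add: lookup_restr when_def)

lemma restr_diff: "restr P (f - g) = restr P f - restr P g" for f :: "'a \<Rightarrow>\<^sub>0 'b::ab_group_add"
  by (rule poly_mapping_eqI) (simp add: lookup_restr lookup_minus when_def)

lemma restr_sum: "restr P (sum f F) = (\<Sum>i\<in>F. restr P (f i))"
  for f :: "'i \<Rightarrow> 'a \<Rightarrow>\<^sub>0 'b::comm_monoid_add"
  by (induction F rule: infinite_finite_induct) (auto simp: restr_add)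

lemma restr_single: "restr P (Poly_Mapping.single w c) = (Poly_Mapping.single w c when P w)"
  by (rule poly_mapping_eqI) (auto simp: lookup_restr lookup_single when_def)

lemma restr_restr: "restr P (restr Q f) = restr (\<lambda>w. P w \<and> Q w) f"
  by (rule poly_mapping_eqI) (auto simp: lookup_restr when_def)

lemma restr_id: "(\<And>w. w \<in> Poly_Mapping.keys f \<Longrightarrow> P w) \<Longrightarrow> restr P f = f"
  by (rule poly_mapping_eqI) (auto simp: lookup_restr when_def in_keys_iff)

lemma restr_eq_0: "(\<And>w. w \<in> Poly_Mapping.keys f \<Longrightarrow> \<not> P w) \<Longrightarrow> restr P f = 0"
  by (rule poly_mapping_eqI) (auto simp: lookup_restr when_def in_keys_iff)

lemma keys_restr: "Poly_Mapping.keys (restr P f) = {w \<in> Poly_Mapping.keys f. P w}"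
  by (auto simp: in_keys_iff lookup_restr when_def split: if_splits)

lemma sum_single_keys: "(\<Sum>w\<in>Poly_Mapping.keys f. Poly_Mapping.single w (Poly_Mapping.lookup f w)) = f"
  by (rule poly_mapping_eqI)
    (auto simp: lookup_sum lookup_single when_def sum.delta' in_keys_iff if_distrib cong: if_cong)

text \<open>Every polynomial is the finite sum of its terms, so identities additive in each factor
  reduce to single words.\<close>

lemma poly_mapping_single_induct [case_names zero add single]:
  fixes f :: "'a \<Rightarrow>\<^sub>0 'b::comm_monoid_add"
  assumes "P 0" "\<And>f g. P f \<Longrightarrow> P g \<Longrightarrow> P (f + g)" "\<And>w c. P (Poly_Mapping.single w c)"
  shows "P f"
proof -
  have "P (\<Sum>w\<in>F. Poly_Mapping.single w (Poly_Mapping.lookup f w))" for F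
    by (induction F rule: infinite_finite_induct) (auto intro: assms)
  then show ?thesis by (metis sum_single_keys)
qed

section \<open>The algebra of words: truncation and grading\<close>

lemma single_mult_list:
  "Poly_Mapping.single u c * Poly_Mapping.single w d = Poly_Mapping.single (u @ w) (c * d)"
  by (simp add: mult_single plus_list_def)

lemma one_eq_single_Nil: "1 = Poly_Mapping.single [] (1::'k::field)"
  by (metis single_one zero_list_def)

lemma single_Nil_commute: "Poly_Mapping.single [] c * f = f * Poly_Mapping.single [] c"
  for c :: "'k::field"
  by (induction f rule: poly_mapping_single_induct)
    (simp_all add: distrib_left distrib_right single_mult_list mult.commute)

lemma mult_scalar_left:
  "x * (Poly_Mapping.single [] c * y) = Poly_Mapping.single [] c * (x * y)" for c :: "'k::field"
  by (metis mult.assoc single_Nil_commute)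

abbreviation words_in :: "'a set \<Rightarrow> ('a list \<Rightarrow>\<^sub>0 'k::field) \<Rightarrow> 'a list \<Rightarrow>\<^sub>0 'k" where
  "words_in X \<equiv> restr (\<lambda>w. w \<in> lists X)"

text \<open>A concatenation is a word over X exactly when both factors are; hence truncation is
  multiplicative.\<close>

lemma words_in_mult: "words_in X (f * g) = words_in X f * words_in X g"
proof (induction f rule: poly_mapping_single_induct)
  case (single w c)
  show ?case
    by (induction g rule: poly_mapping_single_induct)
      (simp_all add: distrib_left restr_add single_mult_list restr_single when_def)
qed (simp_all add: distrib_right restr_add)

abbreviation hom_part :: "int \<Rightarrow> (('v, 'e) lpa_gen list \<Rightarrow>\<^sub>0 'k::field) \<Rightarrow> ('v, 'e) lpa_gen list \<Rightarrow>\<^sub>0 'k" where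
  "hom_part n \<equiv> restr (\<lambda>w. word_deg w = n)"

lemma word_deg_append [simp]: "word_deg (u @ w) = word_deg u + word_deg w"
  by (simp add: word_deg_def)

lemma hom_part_single_mult:
  "hom_part n (Poly_Mapping.single w c * f) = Poly_Mapping.single w c * hom_part (n - word_deg w) f"
  by (induction f rule: poly_mapping_single_induct)
    (auto simp: distrib_left restr_add single_mult_list restr_single when_def)

lemma hom_part_mult_single:
  "hom_part n (f * Poly_Mapping.single w c) = hom_part (n - word_deg w) f * Poly_Mapping.single w c"
  by (induction f rule: poly_mapping_single_induct)
    (auto simp: distrib_right restr_add single_mult_list restr_single when_def)

lemma hom_part_words_in: "hom_part n (words_in X f) = words_in X (hom_part n f)"
  by (simp add: restr_restr conj_commute)

lemma sum_hom_part:
  assumes "finite N" "word_deg ` Poly_Mapping.keys f \<subseteq> N"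
  shows "(\<Sum>n\<in>N. hom_part n f) = f"
proof (rule poly_mapping_eqI)
  fix w
  have "(\<Sum>n\<in>N. Poly_Mapping.lookup f w when word_deg w = n) = Poly_Mapping.lookup f w"
    using assms by (cases "w \<in> Poly_Mapping.keys f") (auto simp: when_def in_keys_iff)
  then show "Poly_Mapping.lookup (\<Sum>n\<in>N. hom_part n f) w = Poly_Mapping.lookup f w"
    by (simp add: lookup_sum lookup_restr)
qed

definition homogeneous :: "int \<Rightarrow> (('v, 'e) lpa_gen list \<Rightarrow>\<^sub>0 'k::field) \<Rightarrow> bool" where
  "homogeneous n f \<longleftrightarrow> (\<forall>w\<in>Poly_Mapping.keys f. word_deg w = n)"

lemma homogeneous_hom_part [simp]: "homogeneous n (hom_part n f)"
  by (simp add: homogeneous_def keys_restr)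

lemma hom_part_homogeneous: "homogeneous n f \<Longrightarrow> hom_part k f = (if k = n then f else 0)"
  by (auto simp: homogeneous_def intro!: restr_id restr_eq_0)

lemma homogeneous_zero [simp]: "homogeneous n 0"
  by (simp add: homogeneous_def)

lemma homogeneous_add: "homogeneous n f \<Longrightarrow> homogeneous n g \<Longrightarrow> homogeneous n (f + g)"
  using Poly_Mapping.keys_add[of f g] by (auto simp: homogeneous_def)

lemma homogeneous_diff: "homogeneous n f \<Longrightarrow> homogeneous n g \<Longrightarrow> homogeneous n (f - g)"
  by (auto simp: homogeneous_def in_keys_iff lookup_minus)

lemma homogeneous_sum: "(\<And>i. i \<in> F \<Longrightarrow> homogeneous n (f i)) \<Longrightarrow> homogeneous n (sum f F)"
  by (induction F rule: infinite_finite_induct) (auto intro: homogeneous_add)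

lemma homogeneous_mult:
  "homogeneous m f \<Longrightarrow> homogeneous n g \<Longrightarrow> homogeneous (m + n) (f * g)"
  using keys_mult[of f g] by (fastforce simp: homogeneous_def plus_list_def)

lemma homogeneous_single: "word_deg w = n \<Longrightarrow> homogeneous n (Poly_Mapping.single w c)"
  by (simp add: homogeneous_def)

section \<open>The defining ideal of a Leavitt path algebra\<close>

text \<open>Membership in the carrier becomes an equation, which rewriting propagates through sums
  and products.\<close>

lemma carrier_free_algebra: "f \<in> carrier (free_algebra X) \<longleftrightarrow> words_in X f = f"
proof
  assume "words_in X f = f"
  then have "Poly_Mapping.keys f = {w \<in> Poly_Mapping.keys f. w \<in> lists X}"
    using keys_restr[of "\<lambda>w. w \<in> lists X" f] by simp
  then show "f \<in> carrier (free_algebra X)"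
    by (auto simp: free_algebra_def)
qed (auto simp: free_algebra_def intro!: restr_id)

lemma ring_free_algebra: "ring (free_algebra X :: ('a list \<Rightarrow>\<^sub>0 'k::field) ring)"
proof (rule ringI)
  let ?R = "free_algebra X :: ('a list \<Rightarrow>\<^sub>0 'k) ring"
  show "abelian_group ?R"
  proof (rule abelian_groupI)
    fix x assume "x \<in> carrier ?R"
    then show "\<exists>y\<in>carrier ?R. y \<oplus>\<^bsub>?R\<^esub> x = \<zero>\<^bsub>?R\<^esub>"
      by (intro bexI[of _ "- x"]) (simp_all add: carrier_free_algebra restr_uminus, simp add: free_algebra_def)
  qed (simp_all add: carrier_free_algebra, simp_all add: free_algebra_def restr_add algebra_simps)
  show "Group.monoid ?R"
    by (rule monoidI)
      (simp_all add: carrier_free_algebra,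
       simp_all add: free_algebra_def words_in_mult one_eq_single_Nil restr_single mult.assoc,
       simp_all flip: one_eq_single_Nil)
qed (simp_all add: free_algebra_def algebra_simps)

lemma free_algebra_ops [simp]:
  "x \<otimes>\<^bsub>free_algebra X\<^esub> y = x * y" "x \<oplus>\<^bsub>free_algebra X\<^esub> y = x + y" "\<zero>\<^bsub>free_algebra X\<^esub> = 0"
  by (simp_all add: free_algebra_def)

lemma a_inv_free_algebra:
  assumes "x \<in> carrier (free_algebra X)" shows "\<ominus>\<^bsub>free_algebra X\<^esub> x = - x"
proof -
  interpret ring "free_algebra X" by (rule ring_free_algebra)
  show ?thesis
    using assms by (intro minus_equality) (auto simp: carrier_free_algebra restr_uminus)
qed

text \<open>
  Restricting to words over \<open>X\<close> is a ring retraction onto the subalgebra of those words; it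
  extends ideals of the subalgebra to ideals of the whole algebra of finitely supported functions,
  which spares us all carrier conditions.
\<close>

lemma ideal_free_algebra_retract:
  assumes "tideal T" "words_in X ` T \<subseteq> T"
  shows "ideal {f \<in> T. words_in X f = f} (free_algebra X)"
proof -
  interpret tideal T by fact
  interpret ring "free_algebra X" by (rule ring_free_algebra)
  show ?thesis
  proof (rule idealI[OF ring_free_algebra])
    show "subgroup {f \<in> T. words_in X f = f} (add_monoid (free_algebra X))"
    proof
      fix x assume x: "x \<in> {f \<in> T. words_in X f = f}"
      then have "inv\<^bsub>add_monoid (free_algebra X)\<^esub> x = - x"
        using a_inv_free_algebra[of x X] by (simp add: carrier_free_algebra a_inv_def)
      with x show "inv\<^bsub>add_monoid (free_algebra X)\<^esub> x \<in> {f \<in> T. words_in X f = f}"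
        by (simp add: uminus restr_uminus)
    qed (auto simp: carrier_free_algebra zero add restr_add)
  qed (auto simp: carrier_free_algebra words_in_mult mult_left mult_right)
qed

text \<open>The set is the preimage of I under the ring homomorphism
  \<open>words_in X\<close>.\<close>

lemma tideal_of_ideal:
  assumes "ideal I (free_algebra X)"
  shows "tideal {f. words_in X f \<in> I}"
proof -
  interpret ideal I "free_algebra X" by fact
  have carr: "words_in X f \<in> carrier (free_algebra X)" for f
    by (simp add: carrier_free_algebra restr_restr)
  show ?thesis
    using additive_subgroup.a_closed[OF is_additive_subgroup]
      additive_subgroup.zero_closed[OF is_additive_subgroup]
      I_l_closed[OF _ carr] I_r_closed[OF _ carr]
    by unfold_locales (auto simp: restr_add words_in_mult)
qed

text \<open>The empty word factors only trivially, so reading off the constant coefficient is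
  multiplicative.\<close>

lemma lookup_mult_Nil:
  "Poly_Mapping.lookup (f * g) [] = Poly_Mapping.lookup f [] * Poly_Mapping.lookup g []"
  for f g :: "'a list \<Rightarrow>\<^sub>0 'k::field"
proof (induction f rule: poly_mapping_single_induct)
  case (single w c)
  show ?case
    by (induction g rule: poly_mapping_single_induct)
      (auto simp: distrib_left lookup_add single_mult_list lookup_single when_def)
qed (simp_all add: distrib_right lookup_add)

lemma tideal_augmentation: "tideal {f :: 'a list \<Rightarrow>\<^sub>0 'k::field. Poly_Mapping.lookup f [] = 0}"
  by unfold_locales (simp_all add: lookup_add lookup_mult_Nil)

text \<open>Multiplication by a word merely shifts homogeneous parts. The lemma serves twice: to
  show that \<open>null\<close> is graded, and to build the largest graded ideal inside M.\<close>

lemma tideal_hom_parts: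
  assumes "tideal S"
  shows "tideal {f. \<forall>n. hom_part n f \<in> S}"
proof -
  interpret tideal S by fact
  have "hom_part n (g * f) \<in> S \<and> hom_part n (f * g) \<in> S" if "\<forall>n. hom_part n f \<in> S" for f g n
    by (induction g rule: poly_mapping_single_induct)
      (use that in \<open>auto simp: distrib_left distrib_right restr_add hom_part_single_mult
        hom_part_mult_single intro: zero add mult_left mult_right\<close>)
  then show ?thesis
    by unfold_locales (auto simp: restr_add zero add)
qed

text \<open>Ghost edges run backwards. With source and range extended to all symbols, the absorption
  relations take the uniform shape of \<open>vt_gen_source\<close> and
  \<open>gen_vt_range\<close>.\<close>

fun lpa_source :: "('v, 'e) pre_digraph \<Rightarrow> ('v, 'e) lpa_gen \<Rightarrow> 'v" where
  "lpa_source E (Vertex v) = v"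
| "lpa_source E (Edge e) = tail E e"
| "lpa_source E (Ghost e) = head E e"

fun lpa_range :: "('v, 'e) pre_digraph \<Rightarrow> ('v, 'e) lpa_gen \<Rightarrow> 'v" where
  "lpa_range E (Vertex v) = v"
| "lpa_range E (Edge e) = head E e"
| "lpa_range E (Ghost e) = tail E e"

text \<open>The type token \<open>K\<close> fixes the coefficient field, which the graph does not
  mention.\<close>

locale lpa = wf_digraph E for E :: "('v, 'e) pre_digraph" +
  fixes K :: "'k::field itself"
begin

abbreviation vt :: "'v \<Rightarrow> ('v, 'e) lpa_gen list \<Rightarrow>\<^sub>0 'k" where "vt v \<equiv> gen (Vertex v)"
abbreviation ed :: "'e \<Rightarrow> ('v, 'e) lpa_gen list \<Rightarrow>\<^sub>0 'k" where "ed e \<equiv> gen (Edge e)"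
abbreviation gh :: "'e \<Rightarrow> ('v, 'e) lpa_gen list \<Rightarrow>\<^sub>0 'k" where "gh e \<equiv> gen (Ghost e)"

abbreviation ideal0 :: "(('v, 'e) lpa_gen list \<Rightarrow>\<^sub>0 'k) set" where
  "ideal0 \<equiv> lpa_ideal E"

text \<open>The defining ideal, extended to all polynomials over the type of symbols: words using a
  symbol outside the graph count as zero.\<close>

definition null :: "(('v, 'e) lpa_gen list \<Rightarrow>\<^sub>0 'k) set" where
  "null = {f. words_in (lpa_gens E) f \<in> ideal0}"

lemma relation_properties:
  fixes r :: "('v, 'e) lpa_gen list \<Rightarrow>\<^sub>0 'k"
  assumes "r \<in> lpa_relations E"
  shows "words_in (lpa_gens E) r = r" "\<exists>n. homogeneous n r" "Poly_Mapping.lookup r [] = 0"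
proof -
  note hom = single_mult_list homogeneous_single word_deg_def
  have "homogeneous 0 (vt v * vt v - vt v)" "homogeneous 0 (vt v * vt w)"
    "homogeneous 1 (vt v * ed e - ed e)" "homogeneous 1 (ed e * vt v - ed e)"
    "homogeneous (-1) (vt v * gh e - gh e)" "homogeneous (-1) (gh e * vt v - gh e)"
    "homogeneous 0 (gh e * ed e - vt v)" "homogeneous 0 (gh e * ed f)"
    "homogeneous 0 (vt v - (\<Sum>e\<in>out_arcs E v. ed e * gh e))" for v w e f
    by (simp_all add: hom homogeneous_diff homogeneous_sum)
  \<comment> \<open>The degree is hidden behind an existential quantifier, so that each of the nine
    kinds of relation is closed by plain matching.\<close>
  note homs = this[THEN exI[of "\<lambda>n. homogeneous n _"]]
  from assms show "\<exists>n. homogeneous n r"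
    unfolding lpa_relations_def Un_iff mem_Collect_eq
    by (elim disjE exE conjE) (simp_all only: homs)
  have "words_in (lpa_gens E) (vt v) = vt v" if "v \<in> verts E" for v
    using that by (simp add: restr_single lpa_gens_def)
  moreover have "words_in (lpa_gens E) (ed e) = ed e" "words_in (lpa_gens E) (gh e) = gh e"
    if "e \<in> arcs E" for e
    using that by (simp_all add: restr_single lpa_gens_def)
  ultimately show "words_in (lpa_gens E) r = r"
    using assms unfolding lpa_relations_def Un_iff mem_Collect_eq regular_vertex_def
    by (elim disjE exE conjE)
      (simp_all add: restr_diff restr_sum words_in_mult cong: sum.cong_simp)
  show "Poly_Mapping.lookup r [] = 0"
    using assms unfolding lpa_relations_def Un_iff mem_Collect_eq
    by (elim disjE exE conjE) (simp_all add: single_mult_list lookup_minus lookup_sum lookup_single)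
qed

lemma ideal_ideal0: "ideal ideal0 (free_algebra (lpa_gens E))"
  unfolding lpa_ideal_def using relation_properties(1)
  by (intro ring.genideal_ideal ring_free_algebra) (auto simp: carrier_free_algebra)

lemma words_in_ideal0: "f \<in> ideal0 \<Longrightarrow> words_in (lpa_gens E) f = f"
  using ideal.Icarr[OF ideal_ideal0] by (simp add: carrier_free_algebra)

lemma relations_in_ideal0: "lpa_relations E \<subseteq> ideal0"
  unfolding lpa_ideal_def using relation_properties(1)
  by (intro ring.genideal_self ring_free_algebra) (auto simp: carrier_free_algebra)

text \<open>The part of T inside the carrier is an ideal of the free algebra that contains the
  generators. This acts as an induction principle for \<open>ideal0\<close>.\<close>

lemma ideal0_minimal:
  assumes "tideal T" "words_in (lpa_gens E) ` T \<subseteq> T" "lpa_relations E \<subseteq> T"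
  shows "ideal0 \<subseteq> T"
  using ring.genideal_minimal[OF ring_free_algebra ideal_free_algebra_retract[OF assms(1,2)],
      of "lpa_relations E"] assms(3) relation_properties(1)
  unfolding lpa_ideal_def by auto

sublocale tideal null
  unfolding null_def by (rule tideal_of_ideal) (rule ideal_ideal0)

notation cong (infix "\<approx>" 50)

lemma ideal0_subset_null: "ideal0 \<subseteq> null"
  by (auto simp: null_def words_in_ideal0)

lemma relation_null: "r \<in> lpa_relations E \<Longrightarrow> r \<in> null"
  using relations_in_ideal0 ideal0_subset_null by blast

lemma words_in_cong: "words_in (lpa_gens E) f \<approx> f"
proof -
  have "words_in (lpa_gens E) f - f \<in> null"
    using zero ideal0_subset_null additive_subgroup.zero_closed[OF ideal.axioms(1)[OF ideal_ideal0]]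
    by (simp add: null_def restr_diff restr_restr)
  then show ?thesis by (simp add: cong_def)
qed

text \<open>The relations are homogeneous, hence so is the ideal that they generate; this is what
  makes L graded.\<close>

lemma null_hom_part: "f \<in> null \<Longrightarrow> hom_part n f \<in> null"
proof -
  let ?T = "{f. \<forall>n. hom_part n f \<in> null}"
  have "words_in (lpa_gens E) g \<in> null" if "g \<in> null" for g
    using that by (simp add: null_def restr_restr)
  then have "words_in (lpa_gens E) ` ?T \<subseteq> ?T"
    by (auto simp: hom_part_words_in)
  moreover have "lpa_relations E \<subseteq> ?T"
  proof
    fix r :: "('v, 'e) lpa_gen list \<Rightarrow>\<^sub>0 'k"
    assume r: "r \<in> lpa_relations E"
    obtain n where "homogeneous n r" using relation_properties(2) r by blast
    then show "r \<in> ?T" using relation_null[OF r] by (simp add: hom_part_homogeneous zero)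
  qed
  ultimately have "ideal0 \<subseteq> ?T"
    by (rule ideal0_minimal[OF tideal_hom_parts[OF tideal_axioms]])
  moreover assume "f \<in> null"
  ultimately have "hom_part n (words_in (lpa_gens E) f) \<in> null"
    by (auto simp: null_def)
  then show ?thesis
    by (simp add: null_def hom_part_words_in restr_restr)
qed

text \<open>The relations have no constant term, so the ideal generated in the unital algebra stays
  inside the non-unital one.\<close>

lemma null_lookup_Nil: "f \<in> null \<Longrightarrow> Poly_Mapping.lookup f [] = 0"
proof -
  have "ideal0 \<subseteq> {f. Poly_Mapping.lookup f [] = 0}"
    using relation_properties(3) by (intro ideal0_minimal tideal_augmentation) (auto simp: lookup_restr)
  moreover assume "f \<in> null"
  ultimately have "Poly_Mapping.lookup (words_in (lpa_gens E) f) [] = 0"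
    by (auto simp: null_def)
  then show ?thesis by (simp add: lookup_restr)
qed

section \<open>Relations between generators modulo \<open>null\<close>\<close>

text \<open>
  Generators outside the graph are zero modulo \<^term>\<open>null\<close>, so most of the relations below hold
  without membership conditions.
\<close>

lemma gen_null: "g \<notin> lpa_gens E \<Longrightarrow> gen g \<in> null"
  using additive_subgroup.zero_closed[OF ideal.axioms(1)[OF ideal_ideal0]]
  by (simp add: null_def restr_single)

lemma cong_0_left: "x \<in> null \<Longrightarrow> x * y \<approx> 0"
  by (simp add: cong_0_iff mult_right)

lemma cong_0_right: "x \<in> null \<Longrightarrow> y * x \<approx> 0"
  by (simp add: cong_0_iff mult_left)

lemma vt_gen_source: "vt (lpa_source E g) * gen g \<approx> gen g"
proof (cases "g \<in> lpa_gens E")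
  case True
  then show ?thesis
    unfolding cong_def by (intro relation_null) (auto simp: lpa_gens_def lpa_relations_def)
next
  case False
  then show ?thesis
    using cong_0_right[OF gen_null] cong_0_iff[of "gen g"] gen_null cong_sym cong_trans by meson
qed

lemma gen_vt_range: "gen g * vt (lpa_range E g) \<approx> gen g"
proof (cases "g \<in> lpa_gens E")
  case True
  then show ?thesis
    unfolding cong_def by (intro relation_null) (auto simp: lpa_gens_def lpa_relations_def)
next
  case False
  then show ?thesis
    using cong_0_left[OF gen_null] cong_0_iff[of "gen g"] gen_null cong_sym cong_trans by meson
qed

lemma vt_vt: "v \<noteq> w \<Longrightarrow> vt v * vt w \<approx> 0"
proof (cases "Vertex v \<in> lpa_gens E \<and> Vertex w \<in> lpa_gens E")
  case True
  assume "v \<noteq> w"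
  with True have "vt v * vt w \<in> lpa_relations E"
    by (auto simp: lpa_gens_def lpa_relations_def)
  then show ?thesis by (simp add: cong_0_iff relation_null)
qed (auto intro: cong_0_left cong_0_right gen_null)

lemma vt_gen: "vt v * gen g \<approx> (if v = lpa_source E g then gen g else 0)"
proof (cases "v = lpa_source E g")
  case False
  have "vt v * gen g \<approx> vt v * (vt (lpa_source E g) * gen g)"
    by (rule cong_left[OF cong_sym[OF vt_gen_source]])
  also have "\<dots> \<approx> 0 * gen g"
    unfolding mult.assoc[symmetric] by (rule cong_right[OF vt_vt[OF False]])
  finally show ?thesis using False by simp
qed (use vt_gen_source in simp)

lemma vt_gen_mult: "vt v * (gen g * x) \<approx> (if v = lpa_source E g then gen g * x else 0)"
  using cong_right[OF vt_gen[of v g], of x]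
  by (cases "v = lpa_source E g") (simp_all add: mult.assoc)

lemma gh_ed_same: "e \<in> arcs E \<Longrightarrow> gh e * ed e \<approx> vt (head E e)"
  unfolding cong_def by (intro relation_null) (auto simp: lpa_relations_def)

lemma gh_ed_other: "e \<noteq> f \<Longrightarrow> gh e * ed f \<approx> 0"
proof (cases "Ghost e \<in> lpa_gens E \<and> Edge f \<in> lpa_gens E")
  case True
  assume "e \<noteq> f"
  with True have "gh e * ed f \<in> lpa_relations E"
    by (auto simp: lpa_gens_def lpa_relations_def)
  then show ?thesis by (simp add: cong_0_iff relation_null)
qed (auto intro: cong_0_left cong_0_right gen_null)

lemma ed_null: "e \<notin> arcs E \<Longrightarrow> ed e \<in> null"
  by (rule gen_null) (auto simp: lpa_gens_def)

lemma gh_null: "e \<notin> arcs E \<Longrightarrow> gh e \<in> null"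
  by (rule gen_null) (auto simp: lpa_gens_def)

lemma local_unit:
  assumes "Poly_Mapping.lookup f [] = 0"
  obtains V where "finite V" "(\<Sum>v\<in>V. vt v) * f \<approx> f"
proof -
  \<comment> \<open>The induction runs over all polynomials, so the constant term is subtracted
    instead of assumed zero. Asking for all larger finite sets allows the sets of two summands to be
    joined.\<close>
  let ?r = "\<lambda>f. f - Poly_Mapping.single [] (Poly_Mapping.lookup f [])"
  let ?P = "\<lambda>f V. finite V \<and> (\<forall>V'. finite V' \<longrightarrow> V \<subseteq> V' \<longrightarrow> (\<Sum>v\<in>V'. vt v) * ?r f \<approx> ?r f)"
  have "\<exists>V. ?P f V"
  proof (induction f rule: poly_mapping_single_induct)
    case zero
    show ?case by auto
  next
    case (add f g)
    from add(1) obtain V where V: "?P f V" ..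
    from add(2) obtain W where W: "?P g W" ..
    have eq: "?r (f + g) = ?r f + ?r g"
      by (simp add: lookup_add single_add)
    have "?P (f + g) (V \<union> W)"
      unfolding eq distrib_left using V W by (auto intro!: cong_add)
    then show ?case ..
  next
    case (single w c)
    show ?case
    proof (cases w)
      case (Cons g u)
      have r: "?r (Poly_Mapping.single w c) = gen g * Poly_Mapping.single u c"
        by (simp add: Cons lookup_single single_mult_list)
      have "(\<Sum>v\<in>V. vt v) * ?r (Poly_Mapping.single w c) \<approx> ?r (Poly_Mapping.single w c)"
        if V: "finite V" "{lpa_source E g} \<subseteq> V" for V
      proof -
        have "(\<Sum>v\<in>V. vt v * (gen g * Poly_Mapping.single u c))
            \<approx> (\<Sum>v\<in>V. if v = lpa_source E g then gen g * Poly_Mapping.single u c else 0)"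
          by (intro cong_sum vt_gen_mult)
        then show ?thesis using V by (simp add: r sum_distrib_right)
      qed
      then show ?thesis by (intro exI[of _ "{lpa_source E g}"]) auto
    qed auto
  qed
  then show ?thesis using that assms by auto
qed


section \<open>Local units of degree zero in ideals\<close>

text \<open>Up to \<^term>\<open>null\<close>, the combinations of ghost paths of length \<open>d\<close> with left end \<open>v\<close>.\<close>

primrec ghost_span :: "'v \<Rightarrow> nat \<Rightarrow> (('v, 'e) lpa_gen list \<Rightarrow>\<^sub>0 'k) set" where
  "ghost_span v 0 = {y. \<exists>c. y \<approx> Poly_Mapping.single [] c * vt v}"
| "ghost_span v (Suc d) = {y. (\<forall>f. y * ed f \<in> ghost_span v d) \<and>
     (\<exists>F. finite F \<and> (\<forall>F'. finite F' \<longrightarrow> F \<subseteq> F' \<longrightarrow> y \<approx> (\<Sum>f\<in>F'. y * ed f * gh f)))}"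

lemma ghost_span_zero: "0 \<in> ghost_span v d"
proof (induction d)
  case 0
  show ?case by (auto intro!: exI[of _ 0])
qed auto

lemma ghost_span_cong: "x \<approx> y \<Longrightarrow> y \<in> ghost_span v d \<Longrightarrow> x \<in> ghost_span v d"
proof (induction d arbitrary: x y)
  case 0
  then show ?case by (auto intro: cong_trans)
next
  case (Suc d)
  then obtain F where F: "finite F"
    "\<And>F'. finite F' \<Longrightarrow> F \<subseteq> F' \<Longrightarrow> y \<approx> (\<Sum>f\<in>F'. y * ed f * gh f)"
    by auto
  have "x * ed f \<in> ghost_span v d" for f
    using Suc.IH[OF cong_right[OF Suc.prems(1)]] Suc.prems(2) by simp
  moreover have "x \<approx> (\<Sum>f\<in>F'. x * ed f * gh f)" if "finite F'" "F \<subseteq> F'" for F'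
  proof -
    note Suc.prems(1)
    also note F(2)[OF that]
    also have "(\<Sum>f\<in>F'. y * ed f * gh f) \<approx> (\<Sum>f\<in>F'. x * ed f * gh f)"
      by (intro cong_sum cong_right cong_sym[OF Suc.prems(1)])
    finally show ?thesis .
  qed
  ultimately show ?case using F(1) by auto
qed

lemma null_ghost_span: "x \<in> null \<Longrightarrow> x \<in> ghost_span v d"
  using ghost_span_cong[of x 0] ghost_span_zero by (simp add: cong_0_iff)

lemma ghost_span_add: "x \<in> ghost_span v d \<Longrightarrow> y \<in> ghost_span v d \<Longrightarrow> x + y \<in> ghost_span v d"
proof (induction d arbitrary: x y)
  case 0
  then obtain a b where "x \<approx> Poly_Mapping.single [] a * vt v" "y \<approx> Poly_Mapping.single [] b * vt v"
    by auto
  from cong_add[OF this] show ?case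
    by (auto simp: distrib_right[symmetric] single_add[symmetric] intro!: exI[of _ "a + b"])
next
  case (Suc d)
  from Suc.prems(1) obtain F where F: "finite F"
    "\<And>F'. finite F' \<Longrightarrow> F \<subseteq> F' \<Longrightarrow> x \<approx> (\<Sum>f\<in>F'. x * ed f * gh f)"
    by auto
  from Suc.prems(2) obtain G where G: "finite G"
    "\<And>F'. finite F' \<Longrightarrow> G \<subseteq> F' \<Longrightarrow> y \<approx> (\<Sum>f\<in>F'. y * ed f * gh f)"
    by auto
  have "x + y \<approx> (\<Sum>f\<in>F'. (x + y) * ed f * gh f)" if "finite F'" "F \<union> G \<subseteq> F'" for F'
    using cong_add[OF F(2)[of F'] G(2)[of F']] that by (simp add: distrib_right sum.distrib)
  then show ?case
    using Suc.IH Suc.prems F(1) G(1) by (auto simp: distrib_right intro!: exI[of _ "F \<union> G"])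
qed

text \<open>Ghost edges are split off on the right, which leaves the left end v untouched.\<close>

lemma vt_ghost_span: "y \<in> ghost_span v d \<Longrightarrow> vt v * y \<approx> y"
proof (induction d arbitrary: y)
  case 0
  then obtain c where c: "y \<approx> Poly_Mapping.single [] c * vt v" by auto
  have "vt v * y \<approx> vt v * (Poly_Mapping.single [] c * vt v)"
    by (rule cong_left[OF c])
  also have "\<dots> = Poly_Mapping.single [] c * (vt v * vt v)"
    by (rule mult_scalar_left)
  also have "\<dots> \<approx> Poly_Mapping.single [] c * vt v"
    using cong_left[OF vt_gen_source[of "Vertex v"]] by simp
  also note cong_sym[OF c]
  finally show ?case .
next
  case (Suc d)
  then obtain F where F: "y \<approx> (\<Sum>f\<in>F. y * ed f * gh f)" by auto
  have "vt v * y \<approx> (\<Sum>f\<in>F. vt v * (y * ed f) * gh f)"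
    using cong_left[OF F, of "vt v"] by (simp add: sum_distrib_left mult.assoc)
  also have "\<dots> \<approx> (\<Sum>f\<in>F. y * ed f * gh f)"
    using Suc by (intro cong_sum cong_right) auto
  also note cong_sym[OF F]
  finally show ?case .
qed

text \<open>A new ghost edge on the left does not interfere with splitting off ghost edges on the
  right; only the base case needs the relations.\<close>

lemma gh_ghost_span: "y \<in> ghost_span (tail E e) d \<Longrightarrow> gh e * y \<in> ghost_span (head E e) (Suc d)"
proof (induction d arbitrary: y)
  case 0
  show ?case
  proof (cases "e \<in> arcs E")
    case True
    from 0 obtain c where c: "y \<approx> Poly_Mapping.single [] c * vt (tail E e)" by auto
    let ?z = "Poly_Mapping.single [] c * gh e"
    have "gh e * y \<approx> gh e * (Poly_Mapping.single [] c * vt (tail E e))"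
      by (rule cong_left[OF c])
    also have "\<dots> = Poly_Mapping.single [] c * (gh e * vt (tail E e))"
      by (rule mult_scalar_left)
    also have "\<dots> \<approx> ?z"
      using cong_left[OF gen_vt_range[of "Ghost e"]] by simp
    finally have z: "gh e * y \<approx> ?z" .
    have same: "?z * ed e \<approx> Poly_Mapping.single [] c * vt (head E e)"
      unfolding mult.assoc by (rule cong_left[OF gh_ed_same[OF True]])
    have other: "?z * ed f \<approx> 0" if "f \<noteq> e" for f
      using cong_left[OF gh_ed_other[of e f], of "Poly_Mapping.single [] c"] that
      by (simp add: mult.assoc)
    have "?z * ed f \<in> ghost_span (head E e) 0" for f
    proof (cases "f = e")
      case False
      then show ?thesis using other by (intro null_ghost_span) (simp add: cong_0_iff)
    qed (use same in auto)
    moreover have "?z \<approx> (\<Sum>f\<in>F. ?z * ed f * gh f)" if "finite F" "{e} \<subseteq> F" for F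
    proof -
      have "(\<Sum>f\<in>F. ?z * ed f * gh f) \<approx> (\<Sum>f\<in>F. if f = e then ?z else 0)"
      proof (rule cong_sum)
        fix f
        show "?z * ed f * gh f \<approx> (if f = e then ?z else 0)"
        proof (cases "f = e")
          case True
          have "?z * ed e * gh e \<approx> Poly_Mapping.single [] c * (vt (head E e) * gh e)"
            using cong_right[OF same, of "gh e"] by (simp add: mult.assoc)
          also have "\<dots> \<approx> ?z"
            using cong_left[OF vt_gen_source[of "Ghost e"]] by simp
          finally show ?thesis using True by simp
        next
          case False
          then show ?thesis using cong_right[OF other, of f "gh f"] by simp
        qed
      qed
      then show ?thesis using that by (simp add: cong_sym)
    qed
    \<comment> \<open>Multiplying by any edge other than e gives zero, so F = {e} is large
      enough.\<close>
    ultimately have "?z \<in> ghost_span (head E e) (Suc 0)"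
      unfolding ghost_span.simps(2) by (auto intro!: exI[of _ "{e}"])
    with z show ?thesis by (rule ghost_span_cong)
  qed (intro null_ghost_span mult_right gh_null)
next
  case (Suc d)
  then obtain F where F: "finite F"
    "\<And>F'. finite F' \<Longrightarrow> F \<subseteq> F' \<Longrightarrow> y \<approx> (\<Sum>f\<in>F'. y * ed f * gh f)"
    by auto
  have "gh e * y * ed f \<in> ghost_span (head E e) (Suc d)" for f
    unfolding mult.assoc using Suc.prems by (intro Suc.IH) auto
  moreover have "gh e * y \<approx> (\<Sum>f\<in>F'. gh e * y * ed f * gh f)" if "finite F'" "F \<subseteq> F'" for F'
    using cong_left[OF F(2)[OF that], of "gh e"] by (simp add: sum_distrib_left mult.assoc)
  ultimately show ?case
    using F(1) unfolding ghost_span.simps(2)[of _ "Suc d"] by blast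
qed

text \<open>
  This is the only place where the coefficients have to be invertible: the ghost paths can be
  stripped off \<open>y\<close> from the right by multiplying with real edges.
\<close>

lemma ghost_span_mult_in_ideal:
  assumes "tideal S" "null \<subseteq> S" "y \<in> ghost_span v d" "w * y \<in> S"
  shows "w * vt v \<in> S \<or> w * y \<approx> 0"
  using assms(3,4)
proof (induction d arbitrary: y)
  case 0
  from 0 obtain c where c: "y \<approx> Poly_Mapping.single [] c * vt v" by auto
  show ?case
  proof (cases "c = 0")
    case True
    then show ?thesis using cong_left[OF c, of w] by simp
  next
    case False
    have "Poly_Mapping.single [] (inverse c) * (w * (Poly_Mapping.single [] c * vt v))
        = Poly_Mapping.single [] (inverse c) * Poly_Mapping.single [] c * (w * vt v)"
      by (subst mult_scalar_left) (simp only: mult.assoc)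
    also have "Poly_Mapping.single [] (inverse c) * Poly_Mapping.single [] c = 1"
      using False by (simp add: single_mult_list one_eq_single_Nil)
    finally have "w * vt v = Poly_Mapping.single [] (inverse c) * (w * (Poly_Mapping.single [] c * vt v))"
      by simp
    moreover have "w * (Poly_Mapping.single [] c * vt v) \<in> S"
      using cong_mem[OF cong_left[OF cong_sym[OF c]]] 0 assms(1,2) by blast
    ultimately show ?thesis using tideal.mult_left[OF assms(1)] by simp
  qed
next
  case (Suc d)
  from Suc.prems obtain F where F: "y \<approx> (\<Sum>f\<in>F. y * ed f * gh f)" by auto
  show ?case
  proof (cases "w * vt v \<in> S")
    case False
    \<comment> \<open>Otherwise the induction hypothesis annihilates every piece of y, and hence
      their sum.\<close>
    have "w * (y * ed f) \<approx> 0" for f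
      using Suc.IH[of "y * ed f"] Suc.prems False tideal.mult_right[OF assms(1), of "w * y" "ed f"]
      by (auto simp: mult.assoc)
    then have "(\<Sum>f\<in>F. w * (y * ed f) * gh f) \<approx> (\<Sum>f\<in>F. 0 * gh f)"
      by (intro cong_sum cong_right)
    then show ?thesis
      using cong_trans[OF cong_left[OF F, of w]] by (simp add: sum_distrib_left mult.assoc)
  qed simp
qed

text \<open>A ghost path of length d has degree -d; in positive degree only the zero class
  remains.\<close>

definition ghost_deg :: "'v \<Rightarrow> int \<Rightarrow> (('v, 'e) lpa_gen list \<Rightarrow>\<^sub>0 'k) set" where
  "ghost_deg v n = (if n > 0 then null else ghost_span v (nat (- n)))"

lemma ghost_deg_cong: "x \<approx> y \<Longrightarrow> y \<in> ghost_deg v n \<Longrightarrow> x \<in> ghost_deg v n"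
  using ghost_span_cong cong_mem[OF _ _ subset_refl tideal_axioms]
  by (auto simp: ghost_deg_def split: if_splits)

lemma null_ghost_deg: "x \<in> null \<Longrightarrow> x \<in> ghost_deg v n"
  by (simp add: ghost_deg_def null_ghost_span)

lemma ghost_deg_add: "x \<in> ghost_deg v n \<Longrightarrow> y \<in> ghost_deg v n \<Longrightarrow> x + y \<in> ghost_deg v n"
  by (simp add: ghost_deg_def ghost_span_add add split: if_splits)

lemma vt_null: "x \<in> null \<Longrightarrow> vt v * x \<approx> x"
  unfolding cong_def by (intro diff mult_left)

lemma vt_ghost_deg: "y \<in> ghost_deg v n \<Longrightarrow> vt v * y \<approx> y"
  by (simp add: ghost_deg_def vt_ghost_span vt_null split: if_splits)

text \<open>Between the factors stand the distinct vertices \<open>tail E e\<close> and v, whose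
  product vanishes.\<close>

lemma gh_mult_other: "vt v * x \<approx> x \<Longrightarrow> v \<noteq> tail E e \<Longrightarrow> gh e * x \<in> null"
proof -
  assume x: "vt v * x \<approx> x" and v: "v \<noteq> tail E e"
  have "gh e * x \<approx> gh e * (vt v * x)"
    by (rule cong_left[OF cong_sym[OF x]])
  also have "\<dots> = gh e * vt v * x"
    by (simp add: mult.assoc)
  also have "\<dots> \<approx> gh e * vt (tail E e) * vt v * x"
    using gen_vt_range[of "Ghost e"] by (intro cong_right) (simp add: cong_sym)
  also have "\<dots> = gh e * (vt (tail E e) * vt v) * x"
    by (simp add: mult.assoc)
  also have "\<dots> \<approx> gh e * 0 * x"
    using v by (intro cong_right cong_left vt_vt) auto
  finally show ?thesis by (simp add: cong_0_iff)
qed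

text \<open>The product is null unless e starts at v and n is at most 0; in that case one more ghost
  edge means one degree less.\<close>

lemma gh_ghost_deg: "y \<in> ghost_deg v n \<Longrightarrow> gh e * y \<in> ghost_deg (head E e) (n - 1)"
proof (cases "v = tail E e \<and> n \<le> 0")
  case True
  assume "y \<in> ghost_deg v n"
  with True have "gh e * y \<in> ghost_span (head E e) (Suc (nat (- n)))"
    by (intro gh_ghost_span) (simp add: ghost_deg_def)
  moreover have "Suc (nat (- n)) = nat (- (n - 1))" using True by (simp add: Suc_nat_eq_nat_zadd1)
  ultimately show ?thesis using True by (simp add: ghost_deg_def)
next
  case False
  assume y: "y \<in> ghost_deg v n"
  have "gh e * y \<in> null"
  proof (cases "v = tail E e")
    case True
    with False y show ?thesis by (simp add: ghost_deg_def mult_left)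
  next
    case False
    with vt_ghost_deg[OF y] show ?thesis by (rule gh_mult_other)
  qed
  then show ?thesis by (rule null_ghost_deg)
qed

text \<open>The 1 makes the formula independent of a vertex. Modulo \<open>null\<close>,
  \<open>corner F * vt v\<close> is v minus the sum of \<open>ed e * gh e\<close> over the edges e
  in F with source v.\<close>

definition corner :: "'e set \<Rightarrow> ('v, 'e) lpa_gen list \<Rightarrow>\<^sub>0 'k" where
  "corner F = 1 - (\<Sum>e\<in>F. ed e * gh e)"

lemma corner_mult: "corner F * x = x - (\<Sum>e\<in>F. ed e * (gh e * x))"
  by (simp add: corner_def left_diff_distrib sum_distrib_right mult.assoc)

text \<open>
  Up to \<^term>\<open>null\<close>, the homogeneous elements of degree \<open>n\<close> with left end \<open>v\<close> that are combinations of
  monomials \<open>p q\<^sup>*\<close> with \<open>p\<close> of length at most \<open>m\<close>. The last condition holds for these because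
  \<^term>\<open>corner F\<close> kills all monomials in which \<open>p\<close> starts with an edge in \<open>F\<close>. Stating it for all
  large \<open>F\<close> makes closure under sums immediate.
\<close>

primrec level :: "nat \<Rightarrow> 'v \<Rightarrow> int \<Rightarrow> (('v, 'e) lpa_gen list \<Rightarrow>\<^sub>0 'k) set" where
  "level 0 v n = ghost_deg v n"
| "level (Suc m) v n = {x. vt v * x \<approx> x \<and> (\<forall>e. gh e * x \<in> level m (head E e) (n - 1)) \<and>
     (\<exists>F. finite F \<and> (\<exists>y\<in>ghost_deg v n. \<forall>F'. finite F' \<longrightarrow> F \<subseteq> F' \<longrightarrow> corner F' * x \<approx> corner F' * y))}"

lemma vt_level: "x \<in> level m v n \<Longrightarrow> vt v * x \<approx> x"
  by (cases m) (auto intro: vt_ghost_deg)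

lemma level_cong: "x \<approx> y \<Longrightarrow> y \<in> level m v n \<Longrightarrow> x \<in> level m v n"
proof (induction m arbitrary: x y v n)
  case 0
  then show ?case by (auto intro: ghost_deg_cong)
next
  case (Suc m)
  from Suc.prems(2) obtain F z where F: "finite F" "z \<in> ghost_deg v n"
    "\<And>F'. finite F' \<Longrightarrow> F \<subseteq> F' \<Longrightarrow> corner F' * y \<approx> corner F' * z"
    by auto
  have "vt v * x \<approx> vt v * y"
    by (rule cong_left[OF Suc.prems(1)])
  also have "\<dots> \<approx> y" using Suc.prems(2) by simp
  also have "\<dots> \<approx> x" using Suc.prems(1) by (rule cong_sym)
  finally have "vt v * x \<approx> x" .
  moreover have "gh e * x \<in> level m (head E e) (n - 1)" for e
    using Suc.IH[OF cong_left[OF Suc.prems(1)]] Suc.prems(2) by simp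
  moreover have "corner F' * x \<approx> corner F' * z" if "finite F'" "F \<subseteq> F'" for F'
    using cong_trans[OF cong_left[OF Suc.prems(1)] F(3)[OF that]] .
  ultimately show ?case using F(1,2) by auto
qed

text \<open>The element is its own witness y, with F empty.\<close>

lemma ghost_deg_level_1: "x \<in> ghost_deg v n \<Longrightarrow> x \<in> level (Suc 0) v n"
  by (auto simp: vt_ghost_deg gh_ghost_deg intro!: exI[of _ "{}"] bexI[of _ x])

lemma level_Suc: "x \<in> level m v n \<Longrightarrow> x \<in> level (Suc m) v n"
proof (induction m arbitrary: x v n)
  case 0
  then show ?case by (simp only: level.simps(1) ghost_deg_level_1)
next
  case (Suc m)
  have "gh e * x \<in> level (Suc m) (head E e) (n - 1)" for e
    using Suc.prems by (intro Suc.IH) simp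
  then show ?case
    using Suc.prems unfolding level.simps(2)[of "Suc m"] by simp
qed

lemma level_mono: "x \<in> level m v n \<Longrightarrow> m \<le> m' \<Longrightarrow> x \<in> level m' v n"
  by (rotate_tac, induction rule: dec_induct) (auto intro: level_Suc simp del: level.simps)

lemma null_level: "x \<in> null \<Longrightarrow> x \<in> level m v n"
  using level_mono[of x 0 v n m] by (simp add: null_ghost_deg)

lemma level_add: "x \<in> level m v n \<Longrightarrow> y \<in> level m v n \<Longrightarrow> x + y \<in> level m v n"
proof (induction m arbitrary: x y v n)
  case 0
  then show ?case by (simp add: ghost_deg_add)
next
  case (Suc m)
  from Suc.prems(1) obtain F z where F: "finite F" "z \<in> ghost_deg v n"
    "\<And>F'. finite F' \<Longrightarrow> F \<subseteq> F' \<Longrightarrow> corner F' * x \<approx> corner F' * z"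
    by auto
  from Suc.prems(2) obtain G u where G: "finite G" "u \<in> ghost_deg v n"
    "\<And>F'. finite F' \<Longrightarrow> G \<subseteq> F' \<Longrightarrow> corner F' * y \<approx> corner F' * u"
    by auto
  have "corner F' * (x + y) \<approx> corner F' * (z + u)" if "finite F'" "F \<union> G \<subseteq> F'" for F'
    using cong_add[OF F(3)[of F'] G(3)[of F']] that by (simp add: distrib_left)
  moreover have "vt v * (x + y) \<approx> x + y"
    using Suc.prems by (simp add: distrib_left cong_add)
  moreover have "gh e * (x + y) \<in> level m (head E e) (n - 1)" for e
    using Suc.prems by (auto simp: distrib_left intro: Suc.IH)
  ultimately show ?case
    using F(1,2) G(1,2)
    by (auto intro!: exI[of _ "F \<union> G"] bexI[of _ "z + u"] ghost_deg_add)
qed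

text \<open>Multiplication by \<open>gh e\<close> gives x back, other ghost edges give zero, and the
  corner kills the product as soon as F contains e. The witnesses are therefore {e} and 0.\<close>

lemma ed_level:
  assumes "x \<in> level m (head E e) n"
  shows "ed e * x \<in> level (Suc m) (tail E e) (n + 1)"
proof (cases "e \<in> arcs E")
  case True
  have same: "gh e * (ed e * x) \<approx> x"
  proof -
    have "gh e * (ed e * x) \<approx> vt (head E e) * x"
      unfolding mult.assoc[symmetric] by (rule cong_right[OF gh_ed_same[OF True]])
    also have "\<dots> \<approx> x" using assms by (rule vt_level)
    finally show ?thesis .
  qed
  have other: "gh f * (ed e * x) \<approx> 0" if "f \<noteq> e" for f
    using cong_right[OF gh_ed_other[OF that], of x] by (simp add: mult.assoc)
  have "vt (tail E e) * (ed e * x) \<approx> ed e * x"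
    using vt_gen_mult[of "tail E e" "Edge e" x] by simp
  moreover have "gh f * (ed e * x) \<in> level m (head E f) (n + 1 - 1)" for f
  proof (cases "f = e")
    case True
    then show ?thesis using level_cong[OF same assms] by simp
  next
    case False
    then show ?thesis using other by (intro null_level) (simp add: cong_0_iff)
  qed
  moreover have "corner F * (ed e * x) \<approx> corner F * 0" if F: "finite F" "{e} \<subseteq> F" for F
  proof -
    have "(\<Sum>f\<in>F. ed f * (gh f * (ed e * x))) \<approx> (\<Sum>f\<in>F. if f = e then ed e * x else 0)"
    proof (rule cong_sum)
      show "ed f * (gh f * (ed e * x)) \<approx> (if f = e then ed e * x else 0)" for f
        using cong_left[OF same, of "ed e"] cong_left[OF other, of f "ed f"] by auto
    qed
    also have "\<dots> = ed e * x" using F by simp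
    finally have "ed e * x - (\<Sum>f\<in>F. ed f * (gh f * (ed e * x))) \<approx> ed e * x - ed e * x"
      by (intro cong_diff cong_refl)
    then show ?thesis by (simp add: corner_mult)
  qed
  ultimately show ?thesis
    by (auto intro!: exI[of _ "{e}"] bexI[of _ 0] null_ghost_deg zero)
qed (intro null_level mult_right ed_null)

text \<open>The level is raised by one and then lowered again by the ghost clause of
  \<open>level (Suc m)\<close>.\<close>

lemma gh_level:
  assumes "x \<in> level m (tail E e) n"
  shows "gh e * x \<in> level m (head E e) (n - 1)"
  using level_Suc[OF assms] by simp

text \<open>The word is built from the right: a real edge raises the level by one, while vertices
  and ghost edges keep it.\<close>

lemma word_level: "\<exists>m. vt v * Poly_Mapping.single u c \<in> level m v (word_deg u)"
proof (induction u arbitrary: v)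
  case Nil
  have "vt v * Poly_Mapping.single [] c \<in> level 0 v (word_deg [])"
    by (auto simp: ghost_deg_def word_deg_def single_Nil_commute[symmetric])
  then show ?case ..
next
  case (Cons g u)
  let ?x = "Poly_Mapping.single u c" and ?y = "vt (lpa_range E g) * Poly_Mapping.single u c"
  have eq: "Poly_Mapping.single (g # u) c = gen g * ?x"
    by (simp add: single_mult_list)
  show ?case
  proof (cases "v = lpa_source E g")
    case False
    then have "vt v * (gen g * ?x) \<approx> 0"
      using vt_gen_mult[of v g ?x] by simp
    then show ?thesis unfolding eq cong_0_iff using null_level by blast
  next
    case True
    have "vt v * (gen g * ?x) \<approx> gen g * ?x"
      using vt_gen_mult[of v g ?x] True by simp
    \<comment> \<open>Inserting the range of g gives the shorter word the left end that the
      induction hypothesis expects.\<close>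
    also have "\<dots> \<approx> gen g * vt (lpa_range E g) * ?x"
      by (rule cong_right[OF cong_sym[OF gen_vt_range]])
    finally have cong: "vt v * Poly_Mapping.single (g # u) c \<approx> gen g * ?y"
      unfolding eq by (simp add: mult.assoc)
    from Cons[of "lpa_range E g"] obtain m where m: "?y \<in> level m (lpa_range E g) (word_deg u)" ..
    have "\<exists>m. gen g * ?y \<in> level m v (word_deg (g # u))"
    proof (cases g)
      case (Vertex w)
      then have "gen g * ?y \<in> level m v (word_deg (g # u))"
        using m True level_cong[OF vt_level[OF m] m] by (simp add: word_deg_def)
      then show ?thesis ..
    next
      case (Edge e)
      then have "gen g * ?y \<in> level (Suc m) v (word_deg (g # u))"
        using m True ed_level[of ?y m e "word_deg u"]
        by (simp add: word_deg_def add.commute del: level.simps)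
      then show ?thesis ..
    next
      case (Ghost e)
      then have "gen g * ?y \<in> level m v (word_deg (g # u))"
        using m True gh_level[of ?y m e "word_deg u"]
        by (simp add: word_deg_def del: level.simps)
      then show ?thesis ..
    qed
    then show ?thesis using level_cong[OF cong] by blast
  qed
qed

lemma homogeneous_level:
  assumes "homogeneous n f"
  shows "\<exists>m. vt v * f \<in> level m v n"
proof -
  have "\<exists>m. vt v * (\<Sum>w\<in>W. Poly_Mapping.single w (Poly_Mapping.lookup f w)) \<in> level m v n"
    if "W \<subseteq> Poly_Mapping.keys f" for W
    using finite_subset[OF that finite_keys] that
  proof (induction W rule: finite_induct)
    case empty
    then show ?case using null_level[OF zero] by auto
  next
    case (insert w W)
    from insert obtain m where
      m: "vt v * (\<Sum>w\<in>W. Poly_Mapping.single w (Poly_Mapping.lookup f w)) \<in> level m v n"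
      by auto
    from insert.prems assms have "word_deg w = n" by (auto simp: homogeneous_def)
    with word_level[of v w "Poly_Mapping.lookup f w"] obtain m' where
      m': "vt v * Poly_Mapping.single w (Poly_Mapping.lookup f w) \<in> level m' v n"
      by auto
    have "vt v * (\<Sum>w\<in>insert w W. Poly_Mapping.single w (Poly_Mapping.lookup f w)) \<in> level (max m m') v n"
      using insert.hyps level_add[OF level_mono[OF m', of "max m m'"] level_mono[OF m, of "max m m'"]]
      by (simp add: distrib_left)
    then show ?case ..
  qed
  from this[OF subset_refl] show ?thesis by (simp only: sum_single_keys)
qed

section \<open>Construction of the local units\<close>

lemma ghost_deg_mult_in_ideal:
  assumes "tideal S" "null \<subseteq> S" "y \<in> ghost_deg v n" "w * y \<in> S"
  shows "w * vt v \<in> S \<or> w * y \<approx> 0"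
proof (cases "n > 0")
  case True
  then have "y \<in> null" using assms(3) by (simp add: ghost_deg_def)
  then show ?thesis by (simp add: cong_0_right)
next
  case False
  then have "y \<in> ghost_span v (nat (- n))" using assms(3) by (simp add: ghost_deg_def)
  from ghost_span_mult_in_ideal[OF assms(1,2) this assms(4)] show ?thesis .
qed

lemma homogeneous_vt: "homogeneous 0 (vt v)"
  by (rule homogeneous_single) (simp add: word_deg_def)

lemma homogeneous_conj: "homogeneous 0 f \<Longrightarrow> homogeneous 0 (ed e * (f * gh e))"
  using homogeneous_mult[of 1 "ed e" "-1" "f * gh e"] homogeneous_mult[of 0 f "-1" "gh e"]
  by (simp add: homogeneous_single word_deg_def)

lemma homogeneous_corner: "homogeneous 0 (corner F)"
proof -
  have one: "homogeneous 0 (1 :: ('v, 'e) lpa_gen list \<Rightarrow>\<^sub>0 'k)"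
    unfolding one_eq_single_Nil by (rule homogeneous_single) (simp add: word_deg_def)
  have "homogeneous 0 (ed e * gh e)" for e
    using homogeneous_conj[OF one] by simp
  with one show ?thesis
    unfolding corner_def by (intro homogeneous_diff homogeneous_sum)
qed

lemma level_local_unit:
  assumes "tideal S" "null \<subseteq> S" "x \<in> level m v n" "x \<in> S"
  shows "\<exists>f\<in>S. homogeneous 0 f \<and> f * x \<approx> x"
  using assms(3,4)
proof (induction m arbitrary: x v n)
  case 0
  then have x: "x \<in> ghost_deg v n" by simp
  \<comment> \<open>Without real edges there is nothing to cut off, so the dichotomy is applied with
    factor 1.\<close>
  have "vt v \<in> S \<or> x \<approx> 0"
    using ghost_deg_mult_in_ideal[OF assms(1,2) x, of 1] 0 by simp
  then show ?case
  proof
    assume "vt v \<in> S"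
    then show ?thesis using homogeneous_vt vt_ghost_deg[OF x] by blast
  next
    assume "x \<approx> 0"
    then have "0 * x \<approx> x" by (simp add: cong_sym)
    then show ?thesis using homogeneous_zero tideal.zero[OF assms(1)] by blast
  qed
next
  case (Suc m)
  from Suc.prems(1) obtain F y where F: "y \<in> ghost_deg v n" "corner F * x \<approx> corner F * y"
    by auto
  have "\<forall>e. \<exists>f. f \<in> S \<and> homogeneous 0 f \<and> f * (gh e * x) \<approx> gh e * x"
  proof
    fix e
    have "gh e * x \<in> level m (head E e) (n - 1)" using Suc.prems(1) by simp
    moreover have "gh e * x \<in> S" by (rule tideal.mult_left[OF assms(1) Suc.prems(2)])
    ultimately show "\<exists>f. f \<in> S \<and> homogeneous 0 f \<and> f * (gh e * x) \<approx> gh e * x"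
      using Suc.IH by blast
  qed
  then obtain g where g: "\<And>e. g e \<in> S" "\<And>e. homogeneous 0 (g e)"
    "\<And>e. g e * (gh e * x) \<approx> gh e * x"
    by metis
  \<comment> \<open>The summand t takes care of the corner part: it is the corner itself if this
    lies in S, and 0 if the corner annihilates x.\<close>
  obtain t where t: "t \<in> S" "homogeneous 0 t" "t * x \<approx> corner F * x"
  proof (cases "corner F * vt v \<in> S")
    case True
    have "corner F * vt v * x \<approx> corner F * x"
      unfolding mult.assoc by (rule cong_left[OF vt_level[OF Suc.prems(1)]])
    moreover have "homogeneous 0 (corner F * vt v)"
      using homogeneous_mult[OF homogeneous_corner homogeneous_vt] by simp
    ultimately show ?thesis using that True by blast
  next
    case False
    have "corner F * y \<in> S"
      using cong_mem[OF cong_sym[OF F(2)]] tideal.mult_left[OF assms(1) Suc.prems(2)] assms(1,2)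
      by blast
    then have "corner F * y \<approx> 0"
      using ghost_deg_mult_in_ideal[OF assms(1,2) F(1)] False by blast
    with F(2) have "corner F * x \<approx> 0" by (rule cong_trans)
    then have "0 * x \<approx> corner F * x" by (simp add: cong_sym)
    then show ?thesis using that[of 0] tideal.zero[OF assms(1)] by simp
  qed
  let ?f = "(\<Sum>e\<in>F. ed e * (g e * gh e)) + t"
  have "?f * x = (\<Sum>e\<in>F. ed e * (g e * (gh e * x))) + t * x"
    by (simp add: distrib_right sum_distrib_right mult.assoc)
  also have "\<dots> \<approx> (\<Sum>e\<in>F. ed e * (gh e * x)) + corner F * x"
    by (intro cong_add cong_sum cong_left g t)
  also have "\<dots> = x" by (simp add: corner_mult)
  finally have "?f * x \<approx> x" .
  moreover have "?f \<in> S"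
    using g(1) t(1)
    by (intro tideal.add[OF assms(1)] tideal.sum[OF assms(1)] tideal.mult_left[OF assms(1)]
        tideal.mult_right[OF assms(1)])
  moreover have "homogeneous 0 ?f"
    using g(2) t(2) by (intro homogeneous_add homogeneous_sum homogeneous_conj)
  ultimately show ?case by blast
qed

text \<open>The element is split by its left ends. In the sum of the \<open>g v * vt v\<close>, each
  unit acts on its own piece \<open>vt v * x\<close>.\<close>

lemma homogeneous_local_unit:
  assumes "tideal S" "null \<subseteq> S" "x \<in> S" "homogeneous n x" "Poly_Mapping.lookup x [] = 0"
  shows "\<exists>f\<in>S. homogeneous 0 f \<and> f * x \<approx> x"
proof -
  from local_unit[OF assms(5)] obtain V where V: "finite V" "(\<Sum>v\<in>V. vt v) * x \<approx> x" .
  have "\<forall>v. \<exists>f. f \<in> S \<and> homogeneous 0 f \<and> f * (vt v * x) \<approx> vt v * x"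
    using homogeneous_level[OF assms(4)] level_local_unit[OF assms(1,2)]
      tideal.mult_left[OF assms(1,3)] by blast
  then obtain g where g: "\<And>v. g v \<in> S" "\<And>v. homogeneous 0 (g v)"
    "\<And>v. g v * (vt v * x) \<approx> vt v * x"
    by metis
  let ?f = "\<Sum>v\<in>V. g v * vt v"
  have "?f * x = (\<Sum>v\<in>V. g v * (vt v * x))"
    by (simp add: sum_distrib_right mult.assoc)
  also have "\<dots> \<approx> (\<Sum>v\<in>V. vt v * x)"
    by (intro cong_sum g)
  also have "\<dots> = (\<Sum>v\<in>V. vt v) * x"
    by (simp add: sum_distrib_right)
  also note V(2)
  finally have "?f * x \<approx> x" .
  moreover have "?f \<in> S"
    using g(1) by (intro tideal.sum[OF assms(1)] tideal.mult_right[OF assms(1)])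
  moreover have "homogeneous 0 ?f"
    using homogeneous_mult[OF g(2) homogeneous_vt] by (intro homogeneous_sum) simp
  ultimately show ?thesis by blast
qed

lemma common_local_unit:
  assumes "tideal S" "null \<subseteq> S" "finite N"
    and "\<And>n. n \<in> N \<Longrightarrow> x n \<in> S \<and> homogeneous n (x n) \<and> Poly_Mapping.lookup (x n) [] = 0"
  shows "\<exists>f\<in>S. homogeneous 0 f \<and> (\<forall>n\<in>N. f * x n \<approx> x n)"
  using assms(3,4)
proof (induction N rule: finite_induct)
  case empty
  then show ?case using homogeneous_zero tideal.zero[OF assms(1)] by blast
next
  case (insert a N)
  then obtain f where f: "f \<in> S" "homogeneous 0 f" "\<And>n. n \<in> N \<Longrightarrow> f * x n \<approx> x n"
    by (metis insertCI)
  let ?z = "x a - f * x a"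
  have a: "x a \<in> S" "homogeneous a (x a)" "Poly_Mapping.lookup (x a) [] = 0"
    using insert.prems by auto
  have "homogeneous a ?z"
    using homogeneous_mult[OF f(2) a(2)] a(2) by (simp add: homogeneous_diff)
  moreover have "?z \<in> S"
    using a(1) by (intro tideal.diff[OF assms(1)] tideal.mult_left[OF assms(1)])
  moreover have "Poly_Mapping.lookup ?z [] = 0"
    by (simp add: lookup_minus lookup_mult_Nil a(3))
  ultimately obtain g where g: "g \<in> S" "homogeneous 0 g" "g * ?z \<approx> ?z"
    using homogeneous_local_unit[OF assms(1,2)] by blast
  \<comment> \<open>Here 1 - h = (1 - g)(1 - f): f fixes the old elements and g fixes what f leaves
    of the new one.\<close>
  let ?h = "f + g - g * f"
  have h: "?h * y = f * y + g * (y - f * y)" for y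
    by (simp add: algebra_simps)
  have "?h * x n \<approx> x n" if "n \<in> insert a N" for n
  proof (cases "n = a")
    case True
    have "f * x a + g * ?z \<approx> f * x a + ?z"
      by (intro cong_add cong_refl g(3))
    then show ?thesis unfolding h True by simp
  next
    case False
    then have n: "f * x n \<approx> x n" using that f(3) by simp
    have "f * x n + g * (x n - f * x n) \<approx> x n + g * (x n - x n)"
      by (intro cong_add n cong_left cong_diff cong_refl)
    then show ?thesis unfolding h by simp
  qed
  moreover have "?h \<in> S"
    by (intro tideal.diff[OF assms(1)] tideal.add[OF assms(1)] tideal.mult_left[OF assms(1)] f g)
  moreover have "homogeneous 0 ?h"
    using homogeneous_mult[OF g(2) f(2)] f(2) g(2) by (simp add: homogeneous_add homogeneous_diff)
  ultimately show ?case by blast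
qed

text \<open>T and S stand for the preimages of M and J. The premise \<open>core\<close> reflects
  that homogeneous elements of M lie in gr(M), hence in J.\<close>

lemma vt_in_graded_ideal:
  assumes "tideal T" "null \<subseteq> T"
    and "tideal S" "null \<subseteq> S" "\<And>f. f \<in> S \<Longrightarrow> Poly_Mapping.lookup f [] = 0"
    and hom: "\<And>f n. f \<in> S \<Longrightarrow> hom_part n f \<in> S"
    and core: "\<And>f. f \<in> T \<Longrightarrow> homogeneous 0 f \<Longrightarrow> f \<in> S"
    and "vt v = t + s" "t \<in> T" "s \<in> S"
  shows "vt v \<in> S"
proof -
  let ?N = "word_deg ` Poly_Mapping.keys s"
  from common_local_unit[OF assms(3,4), of ?N "\<lambda>n. hom_part n s"] hom[OF assms(10)] assms(5)
  obtain f where f: "f \<in> S" "homogeneous 0 f" "\<And>n. n \<in> ?N \<Longrightarrow> f * hom_part n s \<approx> hom_part n s"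
    by auto
  have "(\<Sum>n\<in>?N. f * hom_part n s) \<approx> (\<Sum>n\<in>?N. hom_part n s)"
    by (intro cong_sum f(3))
  then have fs: "f * s \<approx> s"
    using sum_hom_part[of ?N s] by (simp add: sum_distrib_left[symmetric])
  \<comment> \<open>The contribution of s is null because f is a left unit for s.\<close>
  have "vt v - f * vt v = (t - f * t) - (f * s - s)"
    by (simp add: assms(8) algebra_simps)
  also have "\<dots> \<in> T"
  proof (rule tideal.diff[OF assms(1)])
    show "t - f * t \<in> T"
      by (intro tideal.diff[OF assms(1)] tideal.mult_left[OF assms(1)] assms(9))
    show "f * s - s \<in> T"
      using fs assms(2) unfolding cong_def by blast
  qed
  finally have "vt v - f * vt v \<in> T" .
  moreover have "homogeneous 0 (vt v - f * vt v)"
    using homogeneous_mult[OF f(2) homogeneous_vt, of v] homogeneous_vt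
    by (simp add: homogeneous_diff)
  ultimately have "vt v - f * vt v \<in> S" by (rule core)
  from tideal.add[OF assms(3) this tideal.mult_right[OF assms(3) f(1), of "vt v"]]
  show ?thesis by simp
qed


section \<open>Ideals of the Leavitt path algebra as ideals of the free algebra\<close>

abbreviation leavitt_alg :: "(('v, 'e) lpa_gen list \<Rightarrow>\<^sub>0 'k) set ring" ("L") where
  "L \<equiv> leavitt E"

definition proj :: "(('v, 'e) lpa_gen list \<Rightarrow>\<^sub>0 'k) \<Rightarrow> (('v, 'e) lpa_gen list \<Rightarrow>\<^sub>0 'k) set" where
  "proj f = ideal0 +>\<^bsub>free_nonunital_algebra (lpa_gens E)\<^esub> f"

definition pos :: "(('v, 'e) lpa_gen list \<Rightarrow>\<^sub>0 'k) set" where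
  "pos = carrier (free_nonunital_algebra (lpa_gens E))"

lemma pos_iff: "f \<in> pos \<longleftrightarrow> words_in (lpa_gens E) f = f \<and> Poly_Mapping.lookup f [] = 0"
  unfolding carrier_free_algebra[symmetric]
  by (auto simp: pos_def free_nonunital_algebra_def free_algebra_def in_keys_iff)

lemma pos_zero: "0 \<in> pos"
  by (simp add: pos_iff)

lemma pos_add: "f \<in> pos \<Longrightarrow> g \<in> pos \<Longrightarrow> f + g \<in> pos"
  by (simp add: pos_iff restr_add lookup_add)

lemma pos_uminus: "f \<in> pos \<Longrightarrow> - f \<in> pos"
  by (simp add: pos_iff restr_uminus)

lemma pos_sum: "(\<And>i. i \<in> F \<Longrightarrow> f i \<in> pos) \<Longrightarrow> sum f F \<in> pos"
  by (induction F rule: infinite_finite_induct) (auto intro: pos_zero pos_add)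

lemma pos_mult: "f \<in> pos \<Longrightarrow> g \<in> pos \<Longrightarrow> f * g \<in> pos"
  by (simp add: pos_iff words_in_mult lookup_mult_Nil)

lemma pos_hom_part: "f \<in> pos \<Longrightarrow> hom_part n f \<in> pos"
  by (simp add: pos_iff lookup_restr flip: hom_part_words_in)

lemma ideal0_iff: "f \<in> ideal0 \<longleftrightarrow> f \<in> null \<and> words_in (lpa_gens E) f = f"
  by (auto simp: null_def words_in_ideal0)

lemma proj_eq: "proj f = (\<lambda>i. i + f) ` ideal0"
  by (auto simp: proj_def a_r_coset_def r_coset_def free_nonunital_algebra_def free_algebra_def)

lemma ideal0_add: "i \<in> ideal0 \<Longrightarrow> j \<in> ideal0 \<Longrightarrow> i + j \<in> ideal0"
  by (simp add: ideal0_iff add restr_add)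

lemma ideal0_uminus: "i \<in> ideal0 \<Longrightarrow> - i \<in> ideal0"
  by (simp add: ideal0_iff uminus restr_uminus)

lemma ideal0_zero: "0 \<in> ideal0"
  by (simp add: ideal0_iff zero)

lemma mem_proj: "g \<in> proj f \<longleftrightarrow> g - f \<in> ideal0"
  by (force simp: proj_eq)

lemma proj_eq_iff: "proj f = proj g \<longleftrightarrow> f - g \<in> ideal0"
proof
  assume "proj f = proj g"
  moreover have "f \<in> proj f" by (simp add: mem_proj ideal0_zero)
  ultimately show "f - g \<in> ideal0" by (simp add: mem_proj)
next
  assume fg: "f - g \<in> ideal0"
  have "h - f \<in> ideal0 \<longleftrightarrow> h - g \<in> ideal0" for h
    using ideal0_add[OF _ fg, of "h - f"] ideal0_add[OF _ ideal0_uminus[OF fg], of "h - g"] by auto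
  then show "proj f = proj g" by (auto simp: mem_proj)
qed

text \<open>Equality of cosets is congruence modulo \<open>null\<close> only on the carrier, since
  \<open>null\<close> also contains words outside the graph.\<close>

lemma proj_eqI: "f \<in> pos \<Longrightarrow> g \<in> pos \<Longrightarrow> f \<approx> g \<Longrightarrow> proj f = proj g"
  by (simp add: proj_eq_iff ideal0_iff cong_def pos_iff restr_diff)

lemma proj_eqD: "proj f = proj g \<Longrightarrow> f \<approx> g"
  by (simp add: proj_eq_iff ideal0_iff cong_def)

section \<open>The operations of L on representatives\<close>

lemma carrier_leavitt: "carrier L = proj ` pos"
  by (auto simp: leavitt_def FactRing_def A_RCOSETS_def RCOSETS_def proj_def pos_def a_r_coset_def)

lemma zero_leavitt: "\<zero>\<^bsub>L\<^esub> = proj 0"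
  by (simp add: leavitt_def FactRing_def proj_eq)

lemma add_leavitt: "proj f \<oplus>\<^bsub>L\<^esub> proj g = proj (f + g)"
proof -
  have "proj f \<oplus>\<^bsub>L\<^esub> proj g = {a + b | a b. a \<in> proj f \<and> b \<in> proj g}"
    by (auto simp: leavitt_def FactRing_def set_add_def set_mult_def free_nonunital_algebra_def
        free_algebra_def)
  also have "\<dots> = proj (f + g)"
  proof (intro equalityI subsetI)
    fix x assume "x \<in> {a + b | a b. a \<in> proj f \<and> b \<in> proj g}"
    then obtain a b where "x = a + b" "a - f \<in> ideal0" "b - g \<in> ideal0"
      by (auto simp: mem_proj)
    then show "x \<in> proj (f + g)"
      using ideal0_add[of "a - f" "b - g"] by (simp add: mem_proj algebra_simps)
  next
    fix x assume "x \<in> proj (f + g)"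
    then have "x - g \<in> proj f" "g \<in> proj g" "x = (x - g) + g"
      by (simp_all add: mem_proj algebra_simps ideal0_zero)
    then show "x \<in> {a + b | a b. a \<in> proj f \<and> b \<in> proj g}" by blast
  qed
  finally show ?thesis .
qed

lemma mult_leavitt:
  assumes "f \<in> pos" "g \<in> pos"
  shows "proj f \<otimes>\<^bsub>L\<^esub> proj g = proj (f * g)"
proof -
  have "proj f \<otimes>\<^bsub>L\<^esub> proj g = (\<Union>a\<in>proj f. \<Union>b\<in>proj g. proj (a * b))"
    by (simp add: leavitt_def FactRing_def rcoset_mult_def proj_def[symmetric])
      (simp add: free_nonunital_algebra_def free_algebra_def)
  \<comment> \<open>The product of cosets is a union of cosets that all coincide, because the ideal
    absorbs products.\<close>
  also have "\<dots> = (\<Union>a\<in>proj f. \<Union>b\<in>proj g. proj (f * g))"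
  proof (intro SUP_cong refl)
    fix a b assume "a \<in> proj f" "b \<in> proj g"
    then have *: "a - f \<in> ideal0" "b - g \<in> ideal0" by (simp_all add: mem_proj)
    then have w: "words_in (lpa_gens E) a = a" "words_in (lpa_gens E) b = b"
      using assms by (simp_all add: ideal0_iff restr_diff pos_iff)
    from * have "a \<approx> f" "b \<approx> g" by (simp_all add: cong_def ideal0_iff)
    from cong_trans[OF cong_right[OF this(1)] cong_left[OF this(2)]] have "a * b \<approx> f * g" .
    then have "a * b - f * g \<in> ideal0"
      using w assms by (simp add: ideal0_iff cong_def restr_diff words_in_mult pos_iff)
    then show "proj (a * b) = proj (f * g)" by (simp add: proj_eq_iff)
  qed
  also have "\<dots> = proj (f * g)"
    using mem_proj[of f f] mem_proj[of g g] ideal0_zero by auto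
  finally show ?thesis .
qed

text \<open>The additive group is what \<open>finsum\<close> requires; L has no unit in general, so
  the ring locale is out of reach.\<close>

lemma abelian_group_leavitt: "abelian_group L"
proof (rule abelian_groupI)
  fix x assume "x \<in> carrier L"
  then obtain f where "f \<in> pos" "x = proj f" by (auto simp: carrier_leavitt)
  then show "\<exists>y\<in>carrier L. y \<oplus>\<^bsub>L\<^esub> x = \<zero>\<^bsub>L\<^esub>"
    by (intro bexI[of _ "proj (- f)"]) (auto simp: carrier_leavitt add_leavitt zero_leavitt pos_uminus)
qed (auto simp: carrier_leavitt zero_leavitt add_leavitt pos_add pos_zero ac_simps)

lemma finsum_leavitt:
  assumes "finite F" "\<And>i. i \<in> F \<Longrightarrow> f i \<in> pos"
  shows "(\<Oplus>\<^bsub>L\<^esub>i\<in>F. proj (f i)) = proj (sum f F)"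
proof -
  interpret abelian_group L by (rule abelian_group_leavitt)
  show ?thesis
    using assms
  proof (induction F rule: finite_induct)
    case empty
    then show ?case by (simp add: zero_leavitt)
  next
    case (insert i F)
    have "(\<Oplus>\<^bsub>L\<^esub>i\<in>insert i F. proj (f i)) = proj (f i) \<oplus>\<^bsub>L\<^esub> (\<Oplus>\<^bsub>L\<^esub>i\<in>F. proj (f i))"
      using insert by (intro finsum_insert) (auto simp: carrier_leavitt)
    then show ?case using insert by (simp add: add_leavitt)
  qed
qed

lemma leavitt_comp_eq: "leavitt_comp E n = proj ` {f \<in> pos. homogeneous n f}"
  by (auto simp: leavitt_comp_def proj_def pos_def homogeneous_def)

text \<open>The preimage of J, again extended along truncation. Constant terms are excluded, so even
  the preimage of L does not contain 1.\<close>

definition pull :: "(('v, 'e) lpa_gen list \<Rightarrow>\<^sub>0 'k) set set \<Rightarrow> (('v, 'e) lpa_gen list \<Rightarrow>\<^sub>0 'k) set" where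
  "pull J = {f. words_in (lpa_gens E) f \<in> pos \<and> proj (words_in (lpa_gens E) f) \<in> J}"

definition push :: "(('v, 'e) lpa_gen list \<Rightarrow>\<^sub>0 'k) set \<Rightarrow> (('v, 'e) lpa_gen list \<Rightarrow>\<^sub>0 'k) set set" where
  "push S = proj ` (S \<inter> pos)"

lemma push_mono: "S \<subseteq> T \<Longrightarrow> push S \<subseteq> push T"
  by (auto simp: push_def)

lemma pull_lookup_Nil: "f \<in> pull J \<Longrightarrow> Poly_Mapping.lookup f [] = 0"
  by (simp add: pull_def pos_iff lookup_restr)

lemma pull_iff: "f \<in> pos \<Longrightarrow> f \<in> pull J \<longleftrightarrow> proj f \<in> J"
  by (simp add: pull_def pos_iff)

lemma pull_words_in: "f \<in> pull J \<Longrightarrow> words_in (lpa_gens E) f \<in> pull J"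
  by (simp add: pull_def restr_restr)

lemma two_sided_idealD:
  assumes "two_sided_ideal J L"
  shows "J \<subseteq> proj ` pos" "proj 0 \<in> J"
    "proj f \<in> J \<Longrightarrow> proj g \<in> J \<Longrightarrow> proj (f + g) \<in> J"
    "f \<in> pos \<Longrightarrow> g \<in> pos \<Longrightarrow> proj f \<in> J \<Longrightarrow> proj (g * f) \<in> J"
    "f \<in> pos \<Longrightarrow> g \<in> pos \<Longrightarrow> proj f \<in> J \<Longrightarrow> proj (f * g) \<in> J"
proof -
  interpret additive_subgroup J L using assms by (simp add: two_sided_ideal_def)
  show "J \<subseteq> proj ` pos" using a_subset by (simp add: carrier_leavitt)
  show "proj 0 \<in> J" using zero_closed by (simp add: zero_leavitt)
  show "proj f \<in> J \<Longrightarrow> proj g \<in> J \<Longrightarrow> proj (f + g) \<in> J"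
    using a_closed by (simp add: add_leavitt[symmetric])
  show "f \<in> pos \<Longrightarrow> g \<in> pos \<Longrightarrow> proj f \<in> J \<Longrightarrow> proj (g * f) \<in> J"
    "f \<in> pos \<Longrightarrow> g \<in> pos \<Longrightarrow> proj f \<in> J \<Longrightarrow> proj (f * g) \<in> J"
    using assms by (auto simp: two_sided_ideal_def mult_leavitt[symmetric] carrier_leavitt)
qed

text \<open>Ideals of L absorb only elements of L, whereas factors here may have a constant term.
  The gap is closed by local units.\<close>

lemma tideal_pull:
  assumes J: "two_sided_ideal J L"
  shows "tideal (pull J)"
proof -
  note D = two_sided_idealD[OF J]
  let ?w = "words_in (lpa_gens E)"
  have scalar: "proj (Poly_Mapping.single [] c * f) \<in> J" if f: "f \<in> pos" "proj f \<in> J" for c f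
  proof -
    obtain V where V: "finite V" "(\<Sum>v\<in>V. vt v) * f \<approx> f"
      using local_unit f(1) by (auto simp: pos_iff)
    \<comment> \<open>V may contain vertices outside the graph; truncation removes them within the
      same class.\<close>
    let ?u = "?w (\<Sum>v\<in>V. vt v)"
    have u: "?u \<in> pos"
      by (simp add: pos_iff restr_restr lookup_restr lookup_sum lookup_single)
    have cu: "Poly_Mapping.single [] c * ?u \<in> pos"
      using u by (simp add: pos_iff words_in_mult lookup_mult_Nil restr_single)
    have cong: "Poly_Mapping.single [] c * ?u * f \<approx> Poly_Mapping.single [] c * f"
      unfolding mult.assoc
      by (rule cong_left) (rule cong_trans[OF cong_right[OF words_in_cong] V(2)])
    have "Poly_Mapping.single [] c * f \<in> pos"
      using f(1) by (simp add: pos_iff words_in_mult lookup_mult_Nil restr_single)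
    from proj_eqI[OF this pos_mult[OF cu f(1)] cong_sym[OF cong]]
    have "proj (Poly_Mapping.single [] c * f) = proj (Poly_Mapping.single [] c * ?u * f)" .
    then show ?thesis using D(4)[OF f(1) cu f(2)] by simp
  qed
  have mult: "proj (g * f) \<in> J \<and> proj (f * g) \<in> J" if f: "f \<in> pos" "proj f \<in> J" and g: "?w g = g" for f g
  proof -
    \<comment> \<open>The factor is split into its constant term and a part inside the
      carrier.\<close>
    let ?c = "Poly_Mapping.lookup g []"
    let ?g = "g - Poly_Mapping.single [] ?c"
    have "?g \<in> pos" using g by (simp add: pos_iff restr_diff restr_single lookup_minus)
    from D(3)[OF scalar[OF f, of ?c] D(4)[OF f(1) this f(2)]]
      D(3)[OF scalar[OF f, of ?c] D(5)[OF f(1) this f(2)]]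
    moreover have "Poly_Mapping.single [] ?c * f + ?g * f = g * f"
      by (simp add: left_diff_distrib)
    moreover have "Poly_Mapping.single [] ?c * f + f * ?g = f * g"
      by (simp add: right_diff_distrib single_Nil_commute)
    ultimately show ?thesis by (simp only:)
  qed
  show ?thesis
  proof
    show "0 \<in> pull J" using D(2) by (simp add: pull_def pos_zero)
    show "x + y \<in> pull J" if "x \<in> pull J" "y \<in> pull J" for x y
      using that D(3) by (simp add: pull_def restr_add pos_add)
    show "a * x \<in> pull J" "x * a \<in> pull J" if "x \<in> pull J" for x a
      using that mult[of "?w x" "?w a"]
      by (simp_all add: pull_def words_in_mult restr_restr pos_iff lookup_mult_Nil)
  qed
qed

lemma null_subset_pull:
  assumes "two_sided_ideal J L" shows "null \<subseteq> pull J"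
proof
  fix f assume f: "f \<in> null"
  then have w: "words_in (lpa_gens E) f \<in> ideal0" by (simp add: null_def)
  then have "proj (words_in (lpa_gens E) f) = proj 0" by (simp add: proj_eq_iff)
  then show "f \<in> pull J"
    using two_sided_idealD(2)[OF assms] null_lookup_Nil[OF f]
    by (simp add: pull_def pos_iff restr_restr lookup_restr)
qed

lemma push_pull:
  assumes "two_sided_ideal J L" shows "push (pull J) = J"
proof (intro equalityI subsetI)
  fix x assume "x \<in> J"
  moreover from this obtain f where "f \<in> pos" "x = proj f"
    using two_sided_idealD(1)[OF assms] by blast
  ultimately show "x \<in> push (pull J)" by (auto simp: push_def pull_iff)
qed (auto simp: push_def pull_iff)

text \<open>As S contains \<open>null\<close>, membership does not depend on the chosen
  representative.\<close>

lemma proj_in_push: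
  assumes "tideal S" "null \<subseteq> S" "f \<in> pos"
  shows "proj f \<in> push S \<longleftrightarrow> f \<in> S"
  using assms cong_mem[OF proj_eqD] by (auto simp: push_def)

lemma two_sided_ideal_push:
  assumes "tideal S"
  shows "two_sided_ideal (push S) L"
proof -
  interpret L: abelian_group L by (rule abelian_group_leavitt)
  have inv: "\<ominus>\<^bsub>L\<^esub> proj f = proj (- f)" if "f \<in> pos" for f
    using that by (intro L.minus_equality) (auto simp: carrier_leavitt zero_leavitt add_leavitt pos_uminus)
  have "additive_subgroup (push S) L"
  proof (intro additive_subgroup.intro subgroup.intro)
    fix x assume "x \<in> push S"
    then show "inv\<^bsub>add_monoid L\<^esub> x \<in> push S"
      using inv tideal.uminus[OF assms] pos_uminus by (auto simp: push_def a_inv_def)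
  qed (use tideal.zero[OF assms] tideal.add[OF assms] in
      \<open>auto simp: push_def carrier_leavitt zero_leavitt add_leavitt pos_zero pos_add\<close>)
  then show ?thesis
    unfolding two_sided_ideal_def
    using tideal.mult_left[OF assms] tideal.mult_right[OF assms]
    by (auto simp: push_def carrier_leavitt mult_leavitt pos_mult)
qed

section \<open>Graded ideals of L and ideals closed under homogeneous parts\<close>

lemma family_representatives:
  assumes "\<And>n. x n \<in> J \<inter> leavitt_comp E n"
  obtains g where "\<And>n. g n \<in> pos" "\<And>n. homogeneous n (g n)" "\<And>n. x n = proj (g n)"
    "\<And>n. x n = \<zero>\<^bsub>L\<^esub> \<Longrightarrow> g n = 0"
proof -
  \<comment> \<open>The zero class is represented by 0, so that summing representatives over the
    support loses nothing.\<close>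
  have "\<exists>f. f \<in> pos \<and> homogeneous n f \<and> x n = proj f \<and> (x n = \<zero>\<^bsub>L\<^esub> \<longrightarrow> f = 0)" for n
  proof (cases "x n = \<zero>\<^bsub>L\<^esub>")
    case True
    then show ?thesis by (intro exI[of _ 0]) (simp add: pos_zero zero_leavitt)
  next
    case False
    then show ?thesis using assms[of n] by (auto simp: leavitt_comp_eq)
  qed
  then obtain g where "\<And>n. g n \<in> pos \<and> homogeneous n (g n) \<and> x n = proj (g n) \<and> (x n = \<zero>\<^bsub>L\<^esub> \<longrightarrow> g n = 0)"
    by metis
  then show ?thesis by (intro that[of g]) auto
qed

lemma hom_part_sum_homogeneous:
  assumes "\<And>n. homogeneous n (g n)" "finite N" "k \<notin> N \<Longrightarrow> g k = 0"
  shows "hom_part k (sum g N) = g k"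
proof -
  have "hom_part k (sum g N) = (\<Sum>n\<in>N. if n = k then g k else 0)"
    unfolding restr_sum using hom_part_homogeneous[OF assms(1)] by (intro sum.cong) auto
  then show ?thesis using assms(2,3) by auto
qed

lemma graded_ideal_push:
  assumes S: "tideal S" "null \<subseteq> S" and hom: "\<And>f n. f \<in> S \<Longrightarrow> hom_part n f \<in> S"
  shows "graded_ideal (push S) E"
  unfolding graded_ideal_def is_direct_sum_def
proof (intro conjI bij_betw_imageI two_sided_ideal_push S(1))
  let ?supp = "\<lambda>x. {n. x n \<noteq> \<zero>\<^bsub>L\<^esub>}"
  let ?\<Sigma> = "\<lambda>x. \<Oplus>\<^bsub>L\<^esub>n\<in>?supp x. x n"
  let ?X = "{x. (\<forall>n. x n \<in> push S \<inter> leavitt_comp E n) \<and> finite (?supp x)}"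
  \<comment> \<open>Each family is read off from one polynomial as its homogeneous parts.\<close>
  have rep: "\<exists>g. (\<forall>n. g n \<in> pos \<inter> S \<and> x n = proj (g n)) \<and> ?\<Sigma> x = proj (sum g (?supp x))
      \<and> (\<forall>k. hom_part k (sum g (?supp x)) = g k)" if "x \<in> ?X" for x
  proof -
    from that have "x n \<in> push S \<inter> leavitt_comp E n" for n by blast
    from family_representatives[OF this] obtain g where g: "\<And>n. g n \<in> pos"
      "\<And>n. homogeneous n (g n)" "\<And>n. x n = proj (g n)" "\<And>n. x n = \<zero>\<^bsub>L\<^esub> \<Longrightarrow> g n = 0"
      by blast
    have "?\<Sigma> x = (\<Oplus>\<^bsub>L\<^esub>n\<in>?supp x. proj (g n))" by (simp add: g(3))
    also have "\<dots> = proj (sum g (?supp x))"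
      using that g(1) by (intro finsum_leavitt) auto
    finally have "?\<Sigma> x = proj (sum g (?supp x))" .
    moreover have "hom_part k (sum g (?supp x)) = g k" for k
      using that by (intro hom_part_sum_homogeneous g(2)) (auto intro: g(4))
    moreover have "g n \<in> S" for n
    proof -
      have "x n \<in> push S" using that by blast
      then have "proj (g n) \<in> push S" by (simp only: g(3))
      then show ?thesis using proj_in_push[OF S g(1)] by simp
    qed
    ultimately show ?thesis using g(1,3) by blast
  qed
  show "inj_on ?\<Sigma> ?X"
  proof (rule inj_onI)
    fix x y assume xy: "x \<in> ?X" "y \<in> ?X" "?\<Sigma> x = ?\<Sigma> y"
    from rep[OF xy(1)] obtain g where g: "\<forall>n. g n \<in> pos \<inter> S \<and> x n = proj (g n)"
      "?\<Sigma> x = proj (sum g (?supp x))" "\<forall>k. hom_part k (sum g (?supp x)) = g k"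
      by (elim exE conjE) (rule that)
    from rep[OF xy(2)] obtain h where h: "\<forall>n. h n \<in> pos \<inter> S \<and> y n = proj (h n)"
      "?\<Sigma> y = proj (sum h (?supp y))" "\<forall>k. hom_part k (sum h (?supp y)) = h k"
      by (elim exE conjE) (rule that)
    have "proj (sum g (?supp x)) = proj (sum h (?supp y))"
      using xy(3) by (simp only: g(2) h(2))
    \<comment> \<open>Uniqueness of the decomposition rests on \<open>null\<close> being closed
      under homogeneous parts.\<close>
    then have "sum g (?supp x) - sum h (?supp y) \<in> null"
      using proj_eqD by (simp only: cong_def)
    then have "hom_part k (sum g (?supp x)) - hom_part k (sum h (?supp y)) \<in> null" for k
      unfolding restr_diff[symmetric] by (rule null_hom_part)
    then have "g k - h k \<in> null" for k
      by (simp only: g(3) h(3))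
    then have "proj (g k) = proj (h k)" for k
      using g(1) h(1) by (intro proj_eqI) (auto simp: cong_def)
    then have "x k = y k" for k
      using g(1) h(1) by metis
    then show "x = y" by blast
  qed
  show "?\<Sigma> ` ?X = push S"
  proof (intro equalityI subsetI)
    fix z assume "z \<in> ?\<Sigma> ` ?X"
    then obtain x where x: "x \<in> ?X" "z = ?\<Sigma> x" by blast
    from rep[OF x(1)] obtain g where g: "\<forall>n. g n \<in> pos \<inter> S \<and> x n = proj (g n)"
      "?\<Sigma> x = proj (sum g (?supp x))"
      by (elim exE conjE) (rule that)
    have "sum g (?supp x) \<in> S \<inter> pos"
      using g(1) by (intro IntI tideal.sum[OF S(1)] pos_sum) simp_all
    then show "z \<in> push S" unfolding x(2) g(2) push_def by blast
  next
    fix z assume "z \<in> push S"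
    then obtain f where f: "f \<in> S" "f \<in> pos" "z = proj f" by (auto simp: push_def)
    let ?x = "\<lambda>n. proj (hom_part n f)"
    let ?N = "word_deg ` Poly_Mapping.keys f"
    have sub: "?supp ?x \<subseteq> ?N"
    proof
      fix n assume "n \<in> ?supp ?x"
      then have "hom_part n f \<noteq> 0" by (auto simp: zero_leavitt)
      then show "n \<in> ?N" using restr_eq_0[of f "\<lambda>w. word_deg w = n"] by auto
    qed
    then have fin: "finite (?supp ?x)" by (rule finite_subset) simp
    \<comment> \<open>The support can be smaller than the set of occurring degrees: a non-zero
      homogeneous part may be null.\<close>
    have "(\<Sum>n\<in>?N. hom_part n f) \<approx> (\<Sum>n\<in>?N. if n \<in> ?supp ?x then hom_part n f else 0)"
    proof (rule cong_sum)
      fix n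
      show "hom_part n f \<approx> (if n \<in> ?supp ?x then hom_part n f else 0)"
        using proj_eqD[of "hom_part n f" 0] by (simp add: zero_leavitt)
    qed
    also have "\<dots> = (\<Sum>n\<in>?supp ?x. hom_part n f)"
      by (rule sum.mono_neutral_cong_right[OF _ sub]) auto
    finally have "(\<Sum>n\<in>?N. hom_part n f) \<approx> (\<Sum>n\<in>?supp ?x. hom_part n f)" .
    then have cong: "f \<approx> (\<Sum>n\<in>?supp ?x. hom_part n f)"
      by (subst (asm) sum_hom_part) simp_all
    have "z = proj (\<Sum>n\<in>?supp ?x. hom_part n f)"
      unfolding f(3) by (rule proj_eqI[OF f(2) pos_sum[OF pos_hom_part[OF f(2)]] cong])
    also have "\<dots> = ?\<Sigma> ?x"
      by (rule finsum_leavitt[OF fin pos_hom_part[OF f(2)], symmetric])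
    finally have "z = ?\<Sigma> ?x" .
    moreover have "?x \<in> ?X"
      using fin f hom by (auto simp: push_def leavitt_comp_eq pos_hom_part)
    ultimately show "z \<in> ?\<Sigma> ` ?X" by blast
  qed
qed

text \<open>Gradedness makes f congruent to a sum of homogeneous elements of the preimage; comparing
  parts modulo \<open>null\<close> gives the claim.\<close>

lemma hom_part_pull:
  assumes "graded_ideal J E" "f \<in> pull J"
  shows "hom_part k f \<in> pull J"
proof -
  have J: "two_sided_ideal J L" using assms(1) by (simp add: graded_ideal_def)
  let ?f = "words_in (lpa_gens E) f"
  let ?supp = "\<lambda>x. {n. x n \<noteq> \<zero>\<^bsub>L\<^esub>}"
  have "proj ?f \<in> J" using assms(2) by (simp add: pull_def)
  then have "proj ?f \<in> (\<lambda>x. \<Oplus>\<^bsub>L\<^esub>n\<in>?supp x. x n) `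
      {x. (\<forall>n. x n \<in> J \<inter> leavitt_comp E n) \<and> finite (?supp x)}"
    using assms(1) by (simp only: graded_ideal_def is_direct_sum_def bij_betw_def)
  then obtain x where x: "\<And>n. x n \<in> J \<inter> leavitt_comp E n" "finite (?supp x)"
    "proj ?f = (\<Oplus>\<^bsub>L\<^esub>n\<in>?supp x. x n)"
    by blast
  from family_representatives[OF x(1)] obtain g where g: "\<And>n. g n \<in> pos"
    "\<And>n. homogeneous n (g n)" "\<And>n. x n = proj (g n)" "\<And>n. x n = \<zero>\<^bsub>L\<^esub> \<Longrightarrow> g n = 0"
    by blast
  have "proj ?f = (\<Oplus>\<^bsub>L\<^esub>n\<in>?supp x. proj (g n))" using x(3) by (simp add: g(3))
  also have "\<dots> = proj (sum g (?supp x))"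
    using x(2) g(1) by (intro finsum_leavitt) auto
  finally have "?f \<approx> sum g (?supp x)" by (rule proj_eqD)
  with words_in_cong[THEN cong_sym] have "f \<approx> sum g (?supp x)" by (rule cong_trans)
  then have "hom_part k f - hom_part k (sum g (?supp x)) \<in> null"
    unfolding cong_def restr_diff[symmetric] by (rule null_hom_part)
  moreover have "hom_part k (sum g (?supp x)) = g k"
    using x(2) by (intro hom_part_sum_homogeneous g(2)) (auto intro: g(4))
  ultimately have "hom_part k f \<approx> g k" by (simp add: cong_def)
  moreover have "g k \<in> pull J"
    using x(1)[of k] g(1,3) by (simp add: pull_iff)
  ultimately show ?thesis
    using cong_mem null_subset_pull[OF J] tideal_pull[OF J] by blast
qed

section \<open>The largest graded ideal inside an ideal\<close>

text \<open>The preimage of gr(M), described without reference to other graded ideals.\<close>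

definition core :: "(('v, 'e) lpa_gen list \<Rightarrow>\<^sub>0 'k) set set \<Rightarrow> (('v, 'e) lpa_gen list \<Rightarrow>\<^sub>0 'k) set" where
  "core M = {f. \<forall>n. hom_part n f \<in> pull M}"

lemma core_subset_pull:
  assumes "two_sided_ideal M L" shows "core M \<subseteq> pull M"
proof
  fix f assume "f \<in> core M"
  then have "(\<Sum>n\<in>word_deg ` Poly_Mapping.keys f. hom_part n f) \<in> pull M"
    by (intro tideal.sum tideal_pull assms) (simp add: core_def)
  then show "f \<in> pull M" by (simp add: sum_hom_part)
qed

lemma gr_eq:
  assumes M: "two_sided_ideal M L"
  shows "gr E M = push (core M)" "graded_ideal (push (core M)) E" "push (core M) \<subseteq> M"
    "\<And>J. graded_ideal J E \<Longrightarrow> J \<subseteq> M \<Longrightarrow> J \<subseteq> push (core M)"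
proof -
  have core: "tideal (core M)"
    unfolding core_def by (rule tideal_hom_parts) (rule tideal_pull[OF M])
  have "null \<subseteq> core M"
    using null_hom_part null_subset_pull[OF M] by (auto simp: core_def)
  moreover have "hom_part n f \<in> core M" if "f \<in> core M" for f n
    using that tideal.zero[OF tideal_pull[OF M]]
    by (auto simp: core_def hom_part_homogeneous[OF homogeneous_hom_part])
  ultimately show graded: "graded_ideal (push (core M)) E"
    using core by (intro graded_ideal_push)
  show sub: "push (core M) \<subseteq> M"
    using push_mono[OF core_subset_pull[OF M]] by (simp add: push_pull[OF M])
  show greatest: "J \<subseteq> push (core M)" if J: "graded_ideal J E" "J \<subseteq> M" for J
  proof -
    have "pull J \<subseteq> pull M" using J(2) by (auto simp: pull_def)
    \<comment> \<open>The preimage of J is closed under homogeneous parts, so lying in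
      \<open>pull M\<close> suffices for lying in \<open>core M\<close>.\<close>
    then have "pull J \<subseteq> core M"
      using hom_part_pull[OF J(1)] by (auto simp: core_def)
    then have "push (pull J) \<subseteq> push (core M)" by (rule push_mono)
    then show ?thesis using J(1) push_pull by (simp add: graded_ideal_def)
  qed
  show "gr E M = push (core M)"
    unfolding gr_def using graded sub greatest by (intro Greatest_equality) auto
qed

section \<open>Maximality of gr(M) among the proper graded ideals\<close>

lemma maximal_graded_ideal_gr:
  assumes "maximal_ideal M L"
  shows "maximal_graded_ideal (gr E M) E"
proof -
  have M: "two_sided_ideal M L" "M \<noteq> carrier L"
    and max: "\<And>J. two_sided_ideal J L \<Longrightarrow> J \<noteq> carrier L \<Longrightarrow> M \<subseteq> J \<Longrightarrow> J = M"
    using assms by (auto simp: maximal_ideal_def)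
  note gr = gr_eq[OF M(1)]
  have carrier: "I \<subseteq> carrier L" if "two_sided_ideal I L" for I
    using two_sided_idealD(1)[OF that] by (simp add: carrier_leavitt)
  have "push (core M) \<noteq> carrier L"
    using gr(3) M(2) carrier[OF M(1)] by blast
  moreover have "J = push (core M)"
    if J: "graded_ideal J E" "J \<noteq> carrier L" "push (core M) \<subseteq> J" for J
  proof (rule ccontr)
    assume "J \<noteq> push (core M)"
    then have not_sub: "\<not> J \<subseteq> M" using gr(4)[OF J(1)] J(3) by blast
    have idJ: "two_sided_ideal J L" using J(1) by (simp add: graded_ideal_def)
    note T = tideal_pull[OF M(1)] null_subset_pull[OF M(1)]
    note S = tideal_pull[OF idJ] null_subset_pull[OF idJ]
    \<comment> \<open>The sum is formed among the preimages; its image is M + J, which is L by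
      maximality of M.\<close>
    let ?sum = "{t + s | t s. t \<in> pull M \<and> s \<in> pull J}"
    have sum: "tideal ?sum"
    proof
      show "0 \<in> ?sum"
        using tideal.zero[OF T(1)] tideal.zero[OF S(1)] by force
      show "x + y \<in> ?sum" if xy: "x \<in> ?sum" "y \<in> ?sum" for x y
      proof -
        from xy obtain t s t' s' where "x = t + s" "y = t' + s'"
          and ts: "t \<in> pull M" "s \<in> pull J" "t' \<in> pull M" "s' \<in> pull J"
          by blast
        then have "x + y = (t + t') + (s + s')" by (simp add: ac_simps)
        then show ?thesis
          using tideal.add[OF T(1) ts(1,3)] tideal.add[OF S(1) ts(2,4)] by blast
      qed
      show "a * x \<in> ?sum" "x * a \<in> ?sum" if "x \<in> ?sum" for x a
        using that tideal.mult_left[OF T(1)] tideal.mult_left[OF S(1)]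
          tideal.mult_right[OF T(1)] tideal.mult_right[OF S(1)]
        by (auto simp: distrib_left distrib_right) blast+
    qed
    have "pull M \<subseteq> ?sum" "pull J \<subseteq> ?sum"
      using tideal.zero[OF T(1)] tideal.zero[OF S(1)] by force+
    from this[THEN push_mono] have sub: "M \<subseteq> push ?sum" "J \<subseteq> push ?sum"
      by (simp_all add: push_pull M(1) idJ)
    have "push ?sum = carrier L"
    proof (rule ccontr)
      assume "push ?sum \<noteq> carrier L"
      then have "push ?sum = M" by (rule max[OF two_sided_ideal_push[OF sum] _ sub(1)])
      then show False using sub(2) not_sub by simp
    qed
    then have all: "f \<in> ?sum" if "f \<in> pos" for f
      using that proj_in_push[OF sum _ that] \<open>pull M \<subseteq> ?sum\<close> T(2) by (auto simp: carrier_leavitt)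
    \<comment> \<open>A homogeneous element of the preimage of M lies in \<open>core M\<close>, and
      the image of \<open>core M\<close> is inside J by assumption.\<close>
    have core: "f \<in> pull J" if f: "f \<in> pull M" "homogeneous 0 f" for f
    proof -
      have "f \<in> core M"
        using f tideal.zero[OF T(1)] by (simp add: core_def hom_part_homogeneous)
      then have w: "words_in (lpa_gens E) f \<in> core M"
        by (simp add: core_def hom_part_words_in pull_words_in)
      have "words_in (lpa_gens E) f \<in> pos" using f(1) by (simp add: pull_def)
      then have "proj (words_in (lpa_gens E) f) \<in> J"
        using w J(3) by (auto simp: push_def)
      then show ?thesis using \<open>_ \<in> pos\<close> by (simp add: pull_def)
    qed
    have vt: "vt v \<in> pull J" for v
    proof (cases "v \<in> verts E")
      case True
      then have "vt v \<in> pos" by (simp add: pos_iff restr_single lookup_single lpa_gens_def)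
      from all[OF this] obtain t s where "vt v = t + s" "t \<in> pull M" "s \<in> pull J" by blast
      from vt_in_graded_ideal[OF T S pull_lookup_Nil hom_part_pull[OF J(1)] core this]
      show ?thesis .
    next
      case False
      then have "vt v \<in> null" by (intro gen_null) (auto simp: lpa_gens_def)
      then show ?thesis using S(2) by blast
    qed
    \<comment> \<open>Once J contains all vertices, local units put every element of L into
      J.\<close>
    have "proj f \<in> J" if f: "f \<in> pos" for f
    proof -
      obtain V where V: "(\<Sum>v\<in>V. vt v) * f \<approx> f"
        using local_unit f by (auto simp: pos_iff)
      have "(\<Sum>v\<in>V. vt v) * f \<in> pull J"
        using vt by (intro tideal.mult_right[OF S(1)] tideal.sum[OF S(1)])
      then have "f \<in> pull J" by (rule cong_mem[OF cong_sym[OF V] _ S(2,1)])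
      then show ?thesis using f by (simp add: pull_iff)
    qed
    then have "J = carrier L" using carrier[OF idJ] by (auto simp: carrier_leavitt)
    with J(2) show False by contradiction
  qed
  ultimately show ?thesis
    unfolding maximal_graded_ideal_def gr(1) using gr(2) by blast
qed

end

theorem theorem2p5:
  fixes E :: "('v, 'e) pre_digraph"
    and M :: "(('v, 'e) lpa_gen list \<Rightarrow>\<^sub>0 'k::field) set set"
  assumes "wf_digraph E"
    and "maximal_ideal M (leavitt E)"
    and "\<not> graded_ideal M E"
  shows "maximal_graded_ideal (gr E M) E"
proof -
  interpret lpa E "TYPE('k)"
    using assms(1) by (rule lpa.intro)
  from assms(2) show ?thesis by (rule maximal_graded_ideal_gr)
qed

end
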